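(* Let $p\ge 3$ be a prime, let $N$ be a positive integer coprime to $p$, and let $\alpha\ge 0$ be an integer. (1) If $p\equiv 1 \pmod 5$, then $\overline{p}(5p^{10\alpha+9}N)\equiv 0 \pmod 5$. (2) If $p\equiv 2,3,$ or $4 \pmod 5$, then $\overline{p}(5p^{8\alpha+7}N)\equiv 0 \pmod 5$.
   Context: An overpartition of a nonnegative integer $n$ is a partition of $n$ in which the first occurrence of each distinct part may (or may not) be overlined; $\overline{p}(n)$ denotes the number of overpartitions of $n$ (with $\overline{p}(0)=1$). Equivalently, $\sum_{n\ge0}\overline{p}(n)q^n=\prod_{k\ge1}\frac{1+q^k}{1-q^k}$. *)

theory Defs
  imports Main "HOL-Library.Multiset" "HOL-Computational_Algebra.Primes"
begin

text \<open>An overpartition of n: a partition of n (a multiset of positive integers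
summing to n) together with the set of distinct parts whose first occurrence
is overlined.\<close>

definition overpartitions :: "nat \<Rightarrow> (nat multiset \<times> nat set) set" where
  "overpartitions n = {(M, S). (\<forall>k \<in># M. 0 < k) \<and> sum_mset M = n \<and> S \<subseteq> set_mset M}"

definition overpartition_count :: "nat \<Rightarrow> nat" where
  "overpartition_count n = card (overpartitions n)"

end

theory Submission
  imports Defs "HOL-Computational_Algebra.Formal_Power_Series" "HOL-Number_Theory.Cong"
begin

text \<open>
  Since \<open>\<Sum> p\<^sub>o(n) (-q)\<^sup>n = 1 / \<phi>(q)\<close> with \<open>\<phi>(q) = \<Sum> q\<^bsup>j\<^sup>2\<^esup>\<close> (Gauss), where \<open>p\<^sub>o\<close> counts
  overpartitions, and \<open>\<phi>(q)\<^sup>5 \<equiv> \<phi>(q\<^sup>5)\<close> modulo 5, the series \<open>\<Sum> p\<^sub>o(5n) (-q)\<^sup>n\<close> is congruent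
  to \<open>(\<Sum> r\<^sub>4(5n) q\<^sup>n) / \<phi>(q)\<close>. As \<open>r\<^sub>4(5n) \<equiv> r\<^sub>4(n)\<close>, this is \<open>\<phi>(q)\<^sup>3\<close>, so
  \<open>(-1)\<^sup>n p\<^sub>o(5n) \<equiv> r\<^sub>3(n)\<close>. For \<open>p\<close> dividing \<open>n\<close> one has
  \<open>r\<^sub>3(p\<^sup>2 n) = (p + 1) r\<^sub>3(n) - p r\<^sub>3(n / p\<^sup>2)\<close>, whence
  \<open>r\<^sub>3(p\<^bsup>2k+1\<^esup> N) = (1 + p + \<dots> + p\<^sup>k) r\<^sub>3(p N)\<close>, and the geometric sum vanishes modulo 5 for the
  exponents in question.

  Both facts about sums of squares come from double counting with integer quaternions: there are
  \<open>8 (p + 1)\<close> quaternions \<open>\<pi>\<close> of norm \<open>p\<close>, exactly 8 of which satisfy \<open>\<pi> x \<equiv> 0 (mod p)\<close> for a given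
  \<open>x \<not>\<equiv> 0 (mod p)\<close> whose norm is divisible by \<open>p\<close>. For \<open>r\<^sub>4\<close> one counts the products
  \<open>\<pi>\<^sup>* y\<close>, for \<open>r\<^sub>3\<close> the conjugates \<open>\<pi>\<^sup>* y \<pi>\<close> with \<open>y\<close> purely imaginary.
\<close>

section \<open>Integer quaternions\<close>

text \<open>The coordinates with respect to 1, i, j, k are integers, without the half-integral
  points of the Hurwitz order, so that sums of four squares are literally norms.\<close>

datatype iquat = IQuat (q0: int) (q1: int) (q2: int) (q3: int)

lemma iquat_eqI:
  "q0 x = q0 y \<Longrightarrow> q1 x = q1 y \<Longrightarrow> q2 x = q2 y \<Longrightarrow> q3 x = q3 y \<Longrightarrow> x = y"
  by (rule iquat.expand) simp

instantiation iquat :: ring_1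
begin

definition "0 = IQuat 0 0 0 0"
definition "1 = IQuat 1 0 0 0"
definition "x + y = IQuat (q0 x + q0 y) (q1 x + q1 y) (q2 x + q2 y) (q3 x + q3 y)"
definition "x - y = IQuat (q0 x - q0 y) (q1 x - q1 y) (q2 x - q2 y) (q3 x - q3 y)"
definition "- x = IQuat (- q0 x) (- q1 x) (- q2 x) (- q3 x)"
definition "x * y = IQuat
  (q0 x * q0 y - q1 x * q1 y - q2 x * q2 y - q3 x * q3 y)
  (q0 x * q1 y + q1 x * q0 y + q2 x * q3 y - q3 x * q2 y)
  (q0 x * q2 y - q1 x * q3 y + q2 x * q0 y + q3 x * q1 y)
  (q0 x * q3 y + q1 x * q2 y - q2 x * q1 y + q3 x * q0 y)"

instance
  by standard
    (simp_all add: zero_iquat_def one_iquat_def plus_iquat_def minus_iquat_def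
      uminus_iquat_def times_iquat_def algebra_simps)

end

lemma iquat_sel_simps [simp]:
  "q0 0 = 0" "q1 0 = 0" "q2 0 = 0" "q3 0 = 0"
  "q0 1 = 1" "q1 1 = 0" "q2 1 = 0" "q3 1 = 0"
  "q0 (x + y) = q0 x + q0 y" "q1 (x + y) = q1 x + q1 y"
  "q2 (x + y) = q2 x + q2 y" "q3 (x + y) = q3 x + q3 y"
  "q0 (x - y) = q0 x - q0 y" "q1 (x - y) = q1 x - q1 y"
  "q2 (x - y) = q2 x - q2 y" "q3 (x - y) = q3 x - q3 y"
  "q0 (- x) = - q0 x" "q1 (- x) = - q1 x" "q2 (- x) = - q2 x" "q3 (- x) = - q3 x"
  by (simp_all add: zero_iquat_def one_iquat_def plus_iquat_def minus_iquat_def uminus_iquat_def)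

lemma iquat_sel_times:
  "q0 (x * y) = q0 x * q0 y - q1 x * q1 y - q2 x * q2 y - q3 x * q3 y"
  "q1 (x * y) = q0 x * q1 y + q1 x * q0 y + q2 x * q3 y - q3 x * q2 y"
  "q2 (x * y) = q0 x * q2 y - q1 x * q3 y + q2 x * q0 y + q3 x * q1 y"
  "q3 (x * y) = q0 x * q3 y + q1 x * q2 y - q2 x * q1 y + q3 x * q0 y"
  by (simp_all add: times_iquat_def)

lemma iquat_sel_of_nat [simp]:
  "q0 (of_nat n) = int n" "q1 (of_nat n) = 0" "q2 (of_nat n) = 0" "q3 (of_nat n) = 0"
  by (induction n) simp_all

lemma iquat_sel_of_int [simp]:
  "q0 (of_int n) = n" "q1 (of_int n) = 0" "q2 (of_int n) = 0" "q3 (of_int n) = 0"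
  by (cases n; simp)+

lemma iquat_sel_of_int_times [simp]:
  "q0 (of_int m * x) = m * q0 x" "q1 (of_int m * x) = m * q1 x"
  "q2 (of_int m * x) = m * q2 x" "q3 (of_int m * x) = m * q3 x"
  by (simp_all add: iquat_sel_times)

section \<open>Conjugation, norm and trace\<close>

definition qcnj :: "iquat \<Rightarrow> iquat" where
  "qcnj x = IQuat (q0 x) (- q1 x) (- q2 x) (- q3 x)"

definition qnorm :: "iquat \<Rightarrow> int" where
  "qnorm x = q0 x ^ 2 + q1 x ^ 2 + q2 x ^ 2 + q3 x ^ 2"

lemma qcnj_sel [simp]:
  "q0 (qcnj x) = q0 x" "q1 (qcnj x) = - q1 x" "q2 (qcnj x) = - q2 x" "q3 (qcnj x) = - q3 x"
  by (simp_all add: qcnj_def)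

lemma qcnj_mult: "qcnj (x * y) = qcnj y * qcnj x"
  by (rule iquat_eqI) (simp_all add: iquat_sel_times algebra_simps)

lemma qcnj_qcnj [simp]: "qcnj (qcnj x) = x"
  by (rule iquat_eqI) simp_all

lemma qcnj_of_int [simp]: "qcnj (of_int m) = of_int m"
  by (rule iquat_eqI) simp_all

lemma qnorm_qcnj [simp]: "qnorm (qcnj x) = qnorm x"
  by (simp add: qnorm_def)

lemma qnorm_mult: "qnorm (x * y) = qnorm x * qnorm y"
  by (simp add: qnorm_def iquat_sel_times power2_eq_square algebra_simps)

lemma qnorm_of_int [simp]: "qnorm (of_int m) = m ^ 2"
  by (simp add: qnorm_def)

lemma qnorm_0 [simp]: "qnorm 0 = 0"
  by (simp add: qnorm_def)

lemma qnorm_nonneg [simp]: "qnorm x \<ge> 0"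
  by (simp add: qnorm_def)

lemma qnorm_eq_0_iff [simp]: "qnorm x = 0 \<longleftrightarrow> x = 0"
proof
  assume "qnorm x = 0"
  hence "q0 x ^ 2 = 0 \<and> q1 x ^ 2 = 0 \<and> q2 x ^ 2 = 0 \<and> q3 x ^ 2 = 0"
    unfolding qnorm_def by (smt (verit) zero_le_power2)
  thus "x = 0" by (intro iquat_eqI) simp_all
qed simp

lemma mult_qcnj_self: "x * qcnj x = of_int (qnorm x)"
  by (rule iquat_eqI) (simp_all add: iquat_sel_times qnorm_def power2_eq_square)

lemma qcnj_mult_self: "qcnj x * x = of_int (qnorm x)"
  by (rule iquat_eqI) (simp_all add: iquat_sel_times qnorm_def power2_eq_square)

text \<open>The sum of a quaternion and its conjugate is the trace, a scalar; this is how a scalar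
  prime to \<open>p\<close> is later split into two products.\<close>

lemma mult_plus_qcnj: "x * z + qcnj z * qcnj x = of_int (2 * q0 (x * z))"
  by (rule iquat_eqI) (simp_all add: iquat_sel_times del: of_int_mult)

lemma of_int_iquat_commute: "x * of_int m = of_int m * (x :: iquat)"
  by (rule iquat_eqI) (simp_all add: iquat_sel_times)

lemma of_int_iquat_left_commute: "x * (of_int m * y) = of_int m * (x * (y :: iquat))"
  by (rule iquat_eqI) (simp_all add: iquat_sel_times algebra_simps)

lemma of_int_mult_cancel_iquat: "m \<noteq> 0 \<Longrightarrow> of_int m * x = of_int m * (y::iquat) \<longleftrightarrow> x = y"
  by (metis iquat_eqI iquat_sel_of_int_times mult_left_cancel)

lemma iquat_mult_right_cancel:
  assumes "(x::iquat) * z = y * z" "z \<noteq> 0"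
  shows "x = y"
proof -
  have "x * z * qcnj z = y * z * qcnj z" using assms by simp
  hence "of_int (qnorm z) * x = of_int (qnorm z) * y"
    by (simp add: mult.assoc mult_qcnj_self of_int_iquat_commute)
  thus ?thesis using assms(2) of_int_mult_cancel_iquat qnorm_eq_0_iff by blast
qed

text \<open>Multiply the trace of \<open>x * z\<close> by \<open>x\<close> on the right and use that
  \<open>qcnj x * x\<close> is the norm of \<open>x\<close>. Modulo any divisor of that norm,
  \<open>x * z * x\<close> is thus a scalar multiple of \<open>x\<close>.\<close>

lemma mult_sandwich: "x * z * x = of_int (2 * q0 (x * z)) * x - of_int (qnorm x) * qcnj z"
proof -
  have "of_int (2 * q0 (x * z)) * x = x * z * x + qcnj z * qcnj x * x"
    by (simp only: mult_plus_qcnj [symmetric] distrib_right)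
  also have "qcnj z * qcnj x * x = of_int (qnorm x) * qcnj z"
    by (simp add: mult.assoc qcnj_mult_self of_int_iquat_commute)
  finally show ?thesis by simp
qed

section \<open>Congruences modulo rational integers\<close>

definition qdvd :: "int \<Rightarrow> iquat \<Rightarrow> bool" where
  "qdvd m x \<longleftrightarrow> (\<exists>y. x = of_int m * y)"

lemma qdvd_iff: "qdvd m x \<longleftrightarrow> m dvd q0 x \<and> m dvd q1 x \<and> m dvd q2 x \<and> m dvd q3 x"
proof
  assume "m dvd q0 x \<and> m dvd q1 x \<and> m dvd q2 x \<and> m dvd q3 x"
  then obtain a b c d where "q0 x = m * a" "q1 x = m * b" "q2 x = m * c" "q3 x = m * d"
    by (auto elim!: dvdE)
  hence "x = of_int m * IQuat a b c d" by (intro iquat_eqI) simp_all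
  thus "qdvd m x" by (auto simp: qdvd_def)
qed (auto simp: qdvd_def)

lemma qdvd_add: "qdvd m x \<Longrightarrow> qdvd m y \<Longrightarrow> qdvd m (x + y)"
  and qdvd_diff: "qdvd m x \<Longrightarrow> qdvd m y \<Longrightarrow> qdvd m (x - y)"
  and qdvd_minus [simp]: "qdvd m (- x) \<longleftrightarrow> qdvd m x"
  and qdvd_qcnj [simp]: "qdvd m (qcnj x) \<longleftrightarrow> qdvd m x"
  by (auto simp: qdvd_iff)

lemma qdvd_mult_left: "qdvd m x \<Longrightarrow> qdvd m (y * x)"
  by (auto simp: qdvd_def of_int_iquat_left_commute)

lemma qdvd_mult_right: "qdvd m x \<Longrightarrow> qdvd m (x * y)"
  by (auto simp: qdvd_def mult.assoc)

lemma qdvd_of_int_mult: "m dvd t \<Longrightarrow> qdvd m (of_int t * x)"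
  by (auto simp: qdvd_iff)

lemma qdvd_of_int_mult_cancel:
  "k \<noteq> 0 \<Longrightarrow> qdvd (k * m) (of_int k * x) \<longleftrightarrow> qdvd m x"
  by (auto simp: qdvd_iff)

lemma qdvd_of_int_mult_prime:
  "prime p \<Longrightarrow> \<not> p dvd t \<Longrightarrow> qdvd p (of_int t * x) \<longleftrightarrow> qdvd p x"
  by (auto simp: qdvd_iff prime_dvd_mult_iff)

lemma qdvd_imp_dvd_qnorm: "qdvd m x \<Longrightarrow> m ^ 2 dvd qnorm x"
  by (auto simp: qdvd_def qnorm_mult)

lemma qdvd_mult_cong:
  assumes "qdvd m (x - y)"
  shows "qdvd m (z * x) \<longleftrightarrow> qdvd m (z * y)" and "qdvd m (x * z) \<longleftrightarrow> qdvd m (y * z)"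
proof -
  have "qdvd m (z * x - z * y)" "qdvd m (x * z - y * z)"
    using qdvd_mult_left[OF assms, of z] qdvd_mult_right[OF assms, of z]
    by (simp_all add: algebra_simps)
  thus "qdvd m (z * x) \<longleftrightarrow> qdvd m (z * y)" and "qdvd m (x * z) \<longleftrightarrow> qdvd m (y * z)"
    using qdvd_add[of m "z * x - z * y" "z * y"] qdvd_diff[of m "z * x" "z * x - z * y"]
      qdvd_add[of m "x * z - y * z" "y * z"] qdvd_diff[of m "x * z" "x * z - y * z"] by auto
qed

text \<open>The trace form is nondegenerate modulo an odd prime: taking \<open>z\<close> among 1, i,
  j, k recovers each coordinate of \<open>x\<close> up to sign and the factor 2.\<close>

lemma ex_trace_not_dvd:
  assumes "prime (p::int)" "odd p" "\<not> qdvd p x"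
  shows "\<exists>z. \<not> p dvd 2 * q0 (x * z)"
proof -
  have "\<not> p dvd 2" using assms(1,2) zdvd_imp_le[of p 2] prime_ge_2_int[of p] by force
  hence *: "p dvd 2 * a \<longleftrightarrow> p dvd a" for a using assms(1) by (simp add: prime_dvd_mult_iff)
  have "q0 (x * 1) = q0 x" "q0 (x * IQuat 0 1 0 0) = - q1 x"
    "q0 (x * IQuat 0 0 1 0) = - q2 x" "q0 (x * IQuat 0 0 0 1) = - q3 x"
    by (simp_all add: iquat_sel_times)
  thus ?thesis using assms(3) * unfolding qdvd_iff by (metis dvd_minus_iff)
qed

lemma abs_le_square_int: "\<bar>a\<bar> \<le> (a :: int) ^ 2"
  by (cases "a = 0") (use self_le_power[of "\<bar>a\<bar>" 2] in auto)

lemma finite_qnorm_eq: "finite {x. qnorm x = n}"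
proof -
  have "{x. qnorm x = n} \<subseteq> (\<lambda>(a,b,c,d). IQuat a b c d) ` ({-n..n} \<times> {-n..n} \<times> {-n..n} \<times> {-n..n})"
  proof
    fix x assume "x \<in> {x. qnorm x = n}"
    hence n: "n = q0 x ^ 2 + q1 x ^ 2 + q2 x ^ 2 + q3 x ^ 2" by (simp add: qnorm_def)
    have "\<bar>q0 x\<bar> \<le> n \<and> \<bar>q1 x\<bar> \<le> n \<and> \<bar>q2 x\<bar> \<le> n \<and> \<bar>q3 x\<bar> \<le> n"
      using n abs_le_square_int[of "q0 x"] abs_le_square_int[of "q1 x"]
        abs_le_square_int[of "q2 x"] abs_le_square_int[of "q3 x"] by auto
    thus "x \<in> (\<lambda>(a,b,c,d). IQuat a b c d) ` ({-n..n} \<times> {-n..n} \<times> {-n..n} \<times> {-n..n})"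
      by (intro image_eqI[of _ _ "(q0 x, q1 x, q2 x, q3 x)"]) auto
  qed
  thus ?thesis by (rule finite_subset) auto
qed

text \<open>These are the units; they account for the factor 8 in the later counts.\<close>

lemma card_qnorm_1: "card {x. qnorm x = 1} = 8"
proof -
  have *: "\<bar>a\<bar> \<le> 1" if "a ^ 2 \<le> 1" for a :: int
    using that by (simp add: abs_square_le_1)
  have "{x. qnorm x = 1} = {IQuat 1 0 0 0, IQuat (-1) 0 0 0, IQuat 0 1 0 0, IQuat 0 (-1) 0 0,
      IQuat 0 0 1 0, IQuat 0 0 (-1) 0, IQuat 0 0 0 1, IQuat 0 0 0 (-1)}" (is "_ = ?R")
  proof (intro equalityI subsetI)
    fix x assume "x \<in> {x. qnorm x = 1}"
    then obtain a b c d where x: "x = IQuat a b c d" and n: "a ^ 2 + b ^ 2 + c ^ 2 + d ^ 2 = 1"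
      by (cases x) (auto simp: qnorm_def)
    have "a ^ 2 \<le> 1" "b ^ 2 \<le> 1" "c ^ 2 \<le> 1" "d ^ 2 \<le> 1"
      using n by (smt (verit) zero_le_power2)+
    hence "\<bar>a\<bar> \<le> 1" "\<bar>b\<bar> \<le> 1" "\<bar>c\<bar> \<le> 1" "\<bar>d\<bar> \<le> 1"
      by (blast dest: *)+
    hence "a = -1 \<or> a = 0 \<or> a = 1" "b = -1 \<or> b = 0 \<or> b = 1"
      "c = -1 \<or> c = 0 \<or> c = 1" "d = -1 \<or> d = 0 \<or> d = 1"
      by linarith+
    thus "x \<in> ?R" using n unfolding x by (elim disjE) simp_all
  qed (auto simp: qnorm_def)
  thus ?thesis by simp
qed

section \<open>Quaternions of prime norm\<close>

definition annihilators :: "int \<Rightarrow> iquat \<Rightarrow> iquat set" where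
  "annihilators p x = {\<pi>. qnorm \<pi> = p \<and> qdvd p (\<pi> * x)}"

lemma finite_annihilators [simp]: "finite (annihilators p x)"
  by (rule finite_subset[OF _ finite_qnorm_eq[of p]]) (auto simp: annihilators_def)

text \<open>Some \<open>z\<close> makes the trace of \<open>x * z\<close> prime to \<open>p\<close>.
  Inserting this trace between \<open>\<rho>\<close> and \<open>qcnj \<pi>\<close> in the form
  \<open>x * z + qcnj z * qcnj x\<close> gives one term containing \<open>\<rho> * x\<close> and one
  containing \<open>qcnj (\<pi> * x)\<close>, both divisible by \<open>p\<close>.\<close>

lemma qdvd_mult_qcnj_of_common_annihilated:
  assumes p: "prime (p::int)" "odd p" and x: "\<not> qdvd p x"
    and "qdvd p (\<pi> * x)" and "qdvd p (\<rho> * x)"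
  shows "qdvd p (\<rho> * qcnj \<pi>)"
proof -
  obtain z where z: "\<not> p dvd 2 * q0 (x * z)"
    using ex_trace_not_dvd[OF p x] by blast
  have "of_int (2 * q0 (x * z)) * (\<rho> * qcnj \<pi>) = \<rho> * (x * z + qcnj z * qcnj x) * qcnj \<pi>"
    by (simp only: mult_plus_qcnj of_int_iquat_commute of_int_iquat_left_commute mult.assoc)
  also have "\<dots> = (\<rho> * x) * (z * qcnj \<pi>) + \<rho> * qcnj z * qcnj (\<pi> * x)"
    by (simp add: qcnj_mult algebra_simps)
  also have "qdvd p \<dots>"
    by (intro qdvd_add qdvd_mult_right qdvd_mult_left assms) (simp add: assms)
  finally show ?thesis using qdvd_of_int_mult_prime[OF p(1) z] by blast
qed

text \<open>The annihilators form one orbit of the eight units acting from the left: if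
  \<open>\<rho> * qcnj \<pi>\<close> is \<open>p\<close> times \<open>\<epsilon>\<close>, then right
  multiplication by \<open>\<pi>\<close> gives \<open>\<rho> = \<epsilon> * \<pi>\<close>, and
  comparing norms makes \<open>\<epsilon>\<close> a unit.\<close>

lemma card_annihilators_of_nonempty:
  assumes p: "prime (p::int)" "odd p" and x: "\<not> qdvd p x" and \<pi>: "\<pi> \<in> annihilators p x"
  shows "card (annihilators p x) = 8"
proof -
  have p0: "p > 0" using p by (simp add: prime_gt_0_int)
  have \<pi>': "qnorm \<pi> = p" "qdvd p (\<pi> * x)" using \<pi> by (auto simp: annihilators_def)
  have "annihilators p x = (\<lambda>\<epsilon>. \<epsilon> * \<pi>) ` {\<epsilon>. qnorm \<epsilon> = 1}"
  proof (intro equalityI subsetI)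
    fix \<rho> assume "\<rho> \<in> annihilators p x"
    hence \<rho>: "qnorm \<rho> = p" "qdvd p (\<rho> * x)" by (auto simp: annihilators_def)
    obtain \<epsilon> where \<epsilon>: "\<rho> * qcnj \<pi> = of_int p * \<epsilon>"
      using qdvd_mult_qcnj_of_common_annihilated[OF p x \<pi>'(2) \<rho>(2)] by (auto simp: qdvd_def)
    have "of_int p * (\<epsilon> * \<pi>) = \<rho> * (qcnj \<pi> * \<pi>)"
      by (simp add: \<epsilon> mult.assoc [symmetric])
    also have "\<dots> = of_int p * \<rho>" by (simp add: qcnj_mult_self \<pi>' of_int_iquat_commute)
    finally have eq: "\<rho> = \<epsilon> * \<pi>" using p0 of_int_mult_cancel_iquat[of p] by auto
    moreover have "qnorm \<epsilon> = 1"
      using \<rho>(1) \<pi>'(1) p0 unfolding eq qnorm_mult by simp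
    ultimately show "\<rho> \<in> (\<lambda>\<epsilon>. \<epsilon> * \<pi>) ` {\<epsilon>. qnorm \<epsilon> = 1}" by blast
  qed (auto simp: annihilators_def qnorm_mult \<pi>' mult.assoc
      intro!: qdvd_mult_left[OF \<pi>'(2)])
  moreover have "inj_on (\<lambda>\<epsilon>. \<epsilon> * \<pi>) {\<epsilon>. qnorm \<epsilon> = 1}"
    using iquat_mult_right_cancel \<pi>' p0 by (intro inj_onI) force
  ultimately show ?thesis by (simp add: card_image card_qnorm_1)
qed

section \<open>Balanced residues and descent\<close>

lemma ex_balanced_residue:
  fixes m a :: int
  assumes "m > 0"
  shows "\<exists>b. m dvd a - b \<and> 2 * \<bar>b\<bar> \<le> m"
proof (cases "2 * (a mod m) \<le> m")
  case True
  thus ?thesis using assms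
    by (intro exI[of _ "a mod m"]) (simp add: minus_mod_eq_mult_div)
next
  case False
  have "a - (a mod m - m) = m * (a div m + 1)" by (simp add: algebra_simps minus_mod_eq_mult_div)
  moreover have "a mod m < m" using assms by simp
  ultimately show ?thesis using False
    by (intro exI[of _ "a mod m - m"]) (auto simp: abs_if)
qed

lemma ex_balanced_iquat:
  assumes "m > 0"
  shows "\<exists>y. qdvd m (x - y) \<and> 2 * \<bar>q0 y\<bar> \<le> m \<and> 2 * \<bar>q1 y\<bar> \<le> m \<and> 2 * \<bar>q2 y\<bar> \<le> m \<and> 2 * \<bar>q3 y\<bar> \<le> m"
proof -
  obtain a b c d where "m dvd q0 x - a" "2 * \<bar>a\<bar> \<le> m" "m dvd q1 x - b" "2 * \<bar>b\<bar> \<le> m"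
    "m dvd q2 x - c" "2 * \<bar>c\<bar> \<le> m" "m dvd q3 x - d" "2 * \<bar>d\<bar> \<le> m"
    using ex_balanced_residue[OF assms] by metis
  thus ?thesis by (intro exI[of _ "IQuat a b c d"]) (simp add: qdvd_iff)
qed

lemma four_times_square_le:
  assumes "2 * \<bar>a\<bar> \<le> (m::int)"
  shows "4 * a ^ 2 \<le> m ^ 2"
  using power_mono[of "2 * \<bar>a\<bar>" m 2] assms by (simp add: power_mult_distrib)

lemma dvd_qnorm_cong:
  assumes "qdvd m (x - y)"
  shows "m dvd qnorm x - qnorm y"
proof -
  have "m dvd a ^ 2 - b ^ 2" if "m dvd a - b" for a b :: int
    using that by (simp add: power2_eq_square square_diff_square_factored)
  hence "m dvd (q0 x ^ 2 - q0 y ^ 2) + (q1 x ^ 2 - q1 y ^ 2) + (q2 x ^ 2 - q2 y ^ 2) + (q3 x ^ 2 - q3 y ^ 2)"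
    using assms by (intro dvd_add) (auto simp: qdvd_iff)
  thus ?thesis by (simp add: qnorm_def algebra_simps)
qed

text \<open>In the boundary case every coordinate is \<open>\<plusminus> m / 2\<close>, so replacing it by
  a congruent one changes its square by a multiple of \<open>m\<^sup>2\<close>.\<close>

lemma balanced_qnorm:
  assumes m: "m > 0" and y: "qdvd m (x - y)" "2 * \<bar>q0 y\<bar> \<le> m" "2 * \<bar>q1 y\<bar> \<le> m"
    "2 * \<bar>q2 y\<bar> \<le> m" "2 * \<bar>q3 y\<bar> \<le> m"
  shows "qnorm y < m ^ 2 \<or> m ^ 2 dvd qnorm x"
proof (cases "qnorm y < m ^ 2")
  case False
  note le = y(2-)[THEN four_times_square_le]
  have sq: "m ^ 2 dvd a ^ 2 - b ^ 2" if "m dvd a - b" "4 * b ^ 2 = m ^ 2" for a b :: int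
  proof -
    have "(2 * b) ^ 2 = m ^ 2" using that by (simp add: power_mult_distrib)
    hence "m dvd 2 * b" by (metis dvd_refl pow_divides_pow_iff zero_less_numeral)
    hence "m dvd (a - b) + 2 * b" using that dvd_add by blast
    hence "m * m dvd (a - b) * (a + b)" using that by (intro mult_dvd_mono) (auto simp: algebra_simps)
    thus ?thesis by (simp add: power2_eq_square square_diff_square_factored mult.commute)
  qed
  have "4 * q0 y ^ 2 = m ^ 2" "4 * q1 y ^ 2 = m ^ 2" "4 * q2 y ^ 2 = m ^ 2" "4 * q3 y ^ 2 = m ^ 2"
    and n: "qnorm y = m ^ 2"
    using le False unfolding qnorm_def by linarith+
  hence "m ^ 2 dvd (q0 x ^ 2 - q0 y ^ 2) + (q1 x ^ 2 - q1 y ^ 2) + (q2 x ^ 2 - q2 y ^ 2) + (q3 x ^ 2 - q3 y ^ 2)"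
    using y(1) by (intro dvd_add sq) (auto simp: qdvd_iff)
  hence "m ^ 2 dvd qnorm x - m ^ 2" unfolding n[symmetric] by (simp add: qnorm_def algebra_simps)
  hence "m ^ 2 dvd (qnorm x - m ^ 2) + m ^ 2" by (intro dvd_add) auto
  thus ?thesis by simp
qed simp

text \<open>Euler's descent for the four-square theorem: it multiplies by quaternions on the left only,
  so the condition \<open>\<rho> x \<equiv> 0\<close> survives.\<close>

lemma descent_step:
  assumes p: "prime (p::int)" and m: "1 < m" "m < p"
    and \<rho>: "qnorm \<rho> = m * p" "qdvd p (\<rho> * x)"
  shows "\<exists>m' \<tau>. 0 < m' \<and> m' < m \<and> qnorm \<tau> = m' * p \<and> qdvd p (\<tau> * x)"
proof -
  have not_dvd: "\<not> m ^ 2 dvd m * p"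
  proof
    assume "m ^ 2 dvd m * p"
    hence "m dvd p" using m by (simp add: power2_eq_square)
    with p m show False unfolding prime_int_iff by (smt (verit))
  qed
  obtain \<sigma> where \<sigma>: "qdvd m (\<rho> - \<sigma>)" "2 * \<bar>q0 \<sigma>\<bar> \<le> m" "2 * \<bar>q1 \<sigma>\<bar> \<le> m"
    "2 * \<bar>q2 \<sigma>\<bar> \<le> m" "2 * \<bar>q3 \<sigma>\<bar> \<le> m"
    using ex_balanced_iquat[of m \<rho>] m by auto
  have lt: "qnorm \<sigma> < m ^ 2" using balanced_qnorm[OF _ \<sigma>] m not_dvd \<rho> by auto
  have "m dvd qnorm \<rho>" by (simp add: \<rho>)
  hence "m dvd qnorm \<sigma>" using dvd_diff[OF _ dvd_qnorm_cong[OF \<sigma>(1)]] by fastforce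
  then obtain m' where m': "qnorm \<sigma> = m * m'" by auto
  have "\<sigma> \<noteq> 0" using \<sigma>(1) qdvd_imp_dvd_qnorm[of m \<rho>] \<rho>(1) not_dvd by auto
  hence "0 < m * m'" using m' qnorm_nonneg[of \<sigma>] qnorm_eq_0_iff[of \<sigma>] by linarith
  hence m'0: "0 < m'" using m by (simp add: zero_less_mult_iff)
  have "m' < m" using lt m unfolding m' by (simp add: power2_eq_square)
  \<comment> \<open>As \<open>\<sigma>\<close> is congruent to \<open>\<rho>\<close> modulo
    \<open>m\<close>, the product \<open>qcnj \<sigma> * \<rho>\<close> is congruent to the norm of
    \<open>\<rho>\<close>, hence divisible by \<open>m\<close>; the quotient \<open>\<tau>\<close>
    has norm \<open>m * m' * (m * p) / m ^ 2 = m' * p\<close>.\<close>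
  have "qdvd m (qcnj \<rho> * \<rho>)" by (simp add: qcnj_mult_self \<rho> qdvd_iff)
  moreover have "qdvd m (qcnj \<rho> - qcnj \<sigma>)" using \<sigma>(1) by (simp add: qdvd_iff dvd_diff_commute)
  ultimately have "qdvd m (qcnj \<sigma> * \<rho>)" using qdvd_mult_cong(2) by blast
  then obtain \<tau> where \<tau>: "qcnj \<sigma> * \<rho> = of_int m * \<tau>" by (auto simp: qdvd_def)
  have "m * m' * (m * p) = qnorm (qcnj \<sigma> * \<rho>)" by (simp add: qnorm_mult m' \<rho>)
  also have "\<dots> = m ^ 2 * qnorm \<tau>" by (simp add: \<tau> qnorm_mult)
  finally have "qnorm \<tau> = m' * p" using m by (simp add: power2_eq_square)
  moreover have "qdvd p (of_int m * (\<tau> * x))"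
    using qdvd_mult_left[OF \<rho>(2), of "qcnj \<sigma>"] by (simp add: \<tau> mult.assoc[symmetric])
  moreover have "\<not> p dvd m" using m by (auto dest: zdvd_imp_le)
  ultimately have "qdvd p (\<tau> * x)" "qnorm \<tau> = m' * p"
    using qdvd_of_int_mult_prime[OF p] by blast+
  thus ?thesis using m'0 \<open>m' < m\<close> by blast
qed

text \<open>The descent starts from \<open>qcnj x\<close>, since \<open>qcnj x * x\<close> is the
  norm of \<open>x\<close>. Its balanced residue modulo \<open>p\<close> is nonzero, and as
  \<open>p\<close> is odd its coordinates are at most \<open>(p - 1) / 2\<close> in absolute value.
  Its norm is therefore \<open>m * p\<close> with \<open>0 < m < p\<close>, and \<open>m\<close> can
  be lowered to 1.\<close>

lemma annihilators_nonempty: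
  assumes p: "prime (p::int)" "odd p" and x: "\<not> qdvd p x" "p dvd qnorm x"
  shows "annihilators p x \<noteq> {}"
proof -
  have p0: "p > 0" using p by (simp add: prime_gt_0_int)
  have descent: "\<exists>\<pi>. qnorm \<pi> = p \<and> qdvd p (\<pi> * x)"
    if "0 < m" "m < p" "qnorm \<rho> = m * p" "qdvd p (\<rho> * x)" for m \<rho>
    using that
  proof (induction "nat m" arbitrary: m \<rho> rule: less_induct)
    case less
    show ?case
    proof (cases "m = 1")
      case False
      then obtain m' \<tau> where "0 < m'" "m' < m" "qnorm \<tau> = m' * p" "qdvd p (\<tau> * x)"
        using descent_step[OF p(1), of m \<rho> x] less.prems by auto
      thus ?thesis using less.hyps[of m' \<tau>] less.prems by auto
    qed (use less in auto)
  qed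
  obtain \<rho> where \<rho>: "qdvd p (qcnj x - \<rho>)" "2 * \<bar>q0 \<rho>\<bar> \<le> p" "2 * \<bar>q1 \<rho>\<bar> \<le> p"
    "2 * \<bar>q2 \<rho>\<bar> \<le> p" "2 * \<bar>q3 \<rho>\<bar> \<le> p"
    using ex_balanced_iquat[of p "qcnj x"] p0 by auto
  have "2 * \<bar>a\<bar> \<le> p - 1" if "2 * \<bar>a\<bar> \<le> p" for a :: int
    using that p(2) by presburger
  note le = \<rho>(2-)[THEN this, THEN four_times_square_le]
  have "qnorm \<rho> \<le> (p - 1) ^ 2" using le unfolding qnorm_def by linarith
  also have "\<dots> < p ^ 2" using p0 by (intro power_strict_mono) auto
  finally have lt: "qnorm \<rho> < p ^ 2" .
  have "p dvd qnorm \<rho>"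
    using dvd_diff[OF x(2) dvd_qnorm_cong[OF \<rho>(1), unfolded qnorm_qcnj]] by simp
  then obtain m where m: "qnorm \<rho> = p * m" by auto
  have "\<rho> \<noteq> 0" using \<rho>(1) x by auto
  hence "0 < p * m" using m qnorm_nonneg[of \<rho>] qnorm_eq_0_iff[of \<rho>] by linarith
  hence "0 < m" "m < p" using p0 lt unfolding m by (auto simp: zero_less_mult_iff power2_eq_square)
  moreover have "qdvd p (qcnj x * x)" using x by (simp add: qcnj_mult_self qdvd_iff)
  hence "qdvd p (\<rho> * x)" using qdvd_mult_cong(2)[OF \<rho>(1)] by blast
  ultimately show ?thesis using descent[of m \<rho>] m by (auto simp: annihilators_def mult.commute)
qed

lemma card_annihilators:
  assumes "prime (p::int)" "odd p" "\<not> qdvd p x" "p dvd qnorm x"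
  shows "card (annihilators p x) = 8"
  using annihilators_nonempty[OF assms] card_annihilators_of_nonempty[OF assms(1-3)] by blast

text \<open>Pigeonhole: for \<open>h = (p - 1) / 2\<close> the \<open>h + 1\<close> values
  \<open>a ^ 2\<close> with \<open>0 \<le> a \<le> h\<close> are distinct modulo \<open>p\<close>,
  and so are the \<open>h + 1\<close> values \<open>- 1 - b ^ 2\<close>. Since
  \<open>2 * (h + 1) > p\<close>, the two families meet.\<close>

lemma ex_minus_one_sum_two_squares:
  assumes p: "prime (p::int)" "odd p"
  shows "\<exists>a b. p dvd a ^ 2 + b ^ 2 + 1"
proof -
  define h where "h = (p - 1) div 2"
  have h: "p = 2 * h + 1" using p by (auto simp: h_def elim: oddE)
  have p0: "p > 0" using p by (simp add: prime_gt_0_int)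
  have inj: "a = b" if "p dvd a ^ 2 - b ^ 2" "a \<in> {0..h}" "b \<in> {0..h}" for a b
  proof -
    have "p dvd (a - b) * (a + b)" using that(1) 
      by (simp add: power2_eq_square square_diff_square_factored mult.commute)
    hence "p dvd \<bar>a - b\<bar> \<or> p dvd a + b" using p(1) by (auto simp: prime_dvd_mult_iff)
    moreover have "\<bar>a - b\<bar> < p" "0 \<le> a + b" "a + b < p" using that(2,3) h by auto
    ultimately have "\<bar>a - b\<bar> = 0 \<or> a + b = 0"
      by (metis abs_ge_zero order_le_imp_less_or_eq zdvd_not_zless)
    thus ?thesis using that(2,3) by auto
  qed
  define f g where "f = (\<lambda>a. a ^ 2 mod p)" and "g = (\<lambda>b. (- 1 - b ^ 2) mod p)"
  have "inj_on f {0..h}"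
    by (auto intro!: inj_onI inj simp: f_def mod_eq_dvd_iff)
  moreover have "inj_on g {0..h}"
    by (auto intro!: inj_onI inj simp: g_def mod_eq_dvd_iff dvd_diff_commute)
  ultimately have card: "card (f ` {0..h}) = nat (h + 1)" "card (g ` {0..h}) = nat (h + 1)"
    by (simp_all add: card_image)
  have "f ` {0..h} \<inter> g ` {0..h} \<noteq> {}"
  proof
    assume "f ` {0..h} \<inter> g ` {0..h} = {}"
    hence "card (f ` {0..h} \<union> g ` {0..h}) = nat (h + 1) + nat (h + 1)"
      by (subst card_Un_disjoint) (auto simp: card)
    moreover have "f ` {0..h} \<union> g ` {0..h} \<subseteq> {0..<p}"
      using p0 by (auto simp: f_def g_def)
    hence "card (f ` {0..h} \<union> g ` {0..h}) \<le> nat p"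
      using card_mono[of "{0..<p}"] by fastforce
    ultimately show False using h p0 by auto
  qed
  then obtain a b where "a ^ 2 mod p = (- 1 - b ^ 2) mod p" by (auto simp: f_def g_def)
  thus ?thesis by (auto simp: mod_eq_dvd_iff algebra_simps)
qed

section \<open>The number of quaternions of prime norm\<close>

lemma of_int_add_mult_iquat: "of_int (a + b) * x = of_int a * x + of_int b * (x::iquat)"
  by (simp add: algebra_simps)

text \<open>Modulo \<open>p\<close> the integer quaternions form a matrix algebra, and \<open>e = 1 + a i + b j\<close> of norm
  \<open>0\<close> generates a minimal left ideal with basis \<open>e, k e\<close>. An element of norm \<open>p\<close>
  annihilates exactly one of its \<open>p + 1\<close> lines.\<close>

lemma card_qnorm_eq_prime:
  assumes p: "prime (p::int)" "odd p"
  shows "card {\<pi>. qnorm \<pi> = p} = 8 * nat (p + 1)"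
proof -
  have p0: "p > 1" using p by (simp add: prime_gt_1_int)
  obtain a b where ab: "p dvd a ^ 2 + b ^ 2 + 1"
    using ex_minus_one_sum_two_squares[OF p] by blast
  define e where "e = IQuat 1 a b 0"
  define \<kappa> where "\<kappa> = IQuat 0 0 0 1"
  \<comment> \<open>The index \<open>s < p\<close> stands for the line of
    \<open>(s + \<kappa>) * e\<close>, and \<open>s = p\<close> is the point at infinity, the line
    of \<open>e\<close>.\<close>
  define l where "l s = (if s = p then e else (of_int s + \<kappa>) * e)" for s
  have e_norm: "p dvd qnorm e" using ab by (simp add: e_def qnorm_def add_ac)
  have l_ok: "\<not> qdvd p (l s)" "p dvd qnorm (l s)" for s
    using p0 e_norm
    by (auto simp: l_def e_def \<kappa>_def qdvd_iff iquat_sel_times qnorm_mult)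
  \<comment> \<open>Because \<open>\<kappa> * e * \<kappa> = e - 2\<close>, annihilating both basis
    elements would make \<open>p\<close> divide \<open>2 * \<pi>\<close>, hence
    \<open>\<pi>\<close>, against the norm being exactly \<open>p\<close>.\<close>
  have not_both: False if "qnorm \<pi> = p" "qdvd p (\<pi> * e)" "qdvd p (\<pi> * \<kappa> * e)" for \<pi>
  proof -
    have "e - \<kappa> * e * \<kappa> = of_int 2"
      by (rule iquat_eqI) (simp_all add: e_def \<kappa>_def iquat_sel_times del: of_int_numeral)
    hence "of_int 2 * \<pi> = \<pi> * (e - \<kappa> * e * \<kappa>)" by (simp only: of_int_iquat_commute)
    also have "\<dots> = \<pi> * e - \<pi> * \<kappa> * e * \<kappa>" by (simp add: algebra_simps)
    also have "qdvd p \<dots>" by (intro qdvd_diff qdvd_mult_right that)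
    finally have "qdvd p (of_int 2 * \<pi>)" .
    moreover have "\<not> p dvd 2"
    proof
      assume "p dvd 2"
      hence "p = 2" using zdvd_imp_le[of p 2] p0 by simp
      with p show False by simp
    qed
    ultimately have "qdvd p \<pi>" using qdvd_of_int_mult_prime[OF p(1), of 2] by blast
    hence "p * p dvd p * 1" using qdvd_imp_dvd_qnorm[of p \<pi>] that(1) by (simp add: power2_eq_square)
    thus False using p0 by (subst (asm) dvd_mult_cancel_left) auto
  qed
  have split: "\<pi> * ((of_int s + \<kappa>) * e) = of_int s * (\<pi> * e) + \<pi> * \<kappa> * e" for \<pi> s
    by (simp add: algebra_simps of_int_iquat_left_commute)
  have cover: "{\<pi>. qnorm \<pi> = p} = (\<Union>s\<in>{0..p}. annihilators p (l s))"
  proof (intro equalityI subsetI)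
    fix \<pi> assume "\<pi> \<in> {\<pi>. qnorm \<pi> = p}"
    hence n: "qnorm \<pi> = p" by simp
    show "\<pi> \<in> (\<Union>s\<in>{0..p}. annihilators p (l s))"
    proof (cases "qdvd p (\<pi> * e)")
      case True
      thus ?thesis using p0 n by (auto simp: annihilators_def l_def intro!: bexI[of _ p])
    next
      case False
      obtain z where z: "\<not> p dvd 2 * q0 (\<pi> * e * z)"
        using ex_trace_not_dvd[OF p False] by blast
      \<comment> \<open>Evaluating \<open>\<pi> * e * z * \<pi> * \<kappa> * e\<close> by
        \<open>mult_sandwich\<close> in two ways, around \<open>\<pi>\<close> and around
        \<open>e\<close>, shows that \<open>\<tau> * (\<pi> * \<kappa> * e)\<close> and
        \<open>\<sigma> * (\<pi> * e)\<close> agree modulo \<open>p\<close>. As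
        \<open>\<tau>\<close> is invertible, the line killed by \<open>\<pi>\<close> comes from
        solving \<open>\<tau> * s + \<sigma> = 0\<close> modulo \<open>p\<close>.\<close>
      define \<tau> \<sigma> where "\<tau> = 2 * q0 (\<pi> * e * z)" and "\<sigma> = 2 * q0 (e * (z * \<pi> * \<kappa>))"
      have 1: "\<pi> * (e * z) * \<pi> = of_int \<tau> * \<pi> - of_int p * qcnj (e * z)"
        using mult_sandwich[of \<pi> "e * z"] by (simp only: \<tau>_def n mult.assoc)
      have 2: "e * (z * \<pi> * \<kappa>) * e = of_int \<sigma> * e - of_int (qnorm e) * qcnj (z * \<pi> * \<kappa>)"
        using mult_sandwich[of e "z * \<pi> * \<kappa>"] by (simp only: \<sigma>_def)
      have "of_int \<tau> * (\<pi> * \<kappa> * e) - of_int p * (qcnj (e * z) * \<kappa> * e) = (\<pi> * (e * z) * \<pi>) * (\<kappa> * e)"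
        unfolding 1 by (simp add: algebra_simps)
      also have "\<dots> = \<pi> * (e * (z * \<pi> * \<kappa>) * e)" by (simp add: mult.assoc)
      also have "\<dots> = of_int \<sigma> * (\<pi> * e) - of_int (qnorm e) * (\<pi> * qcnj (z * \<pi> * \<kappa>))"
        unfolding 2 by (simp add: right_diff_distrib of_int_iquat_left_commute)
      finally have 3: "of_int \<tau> * (\<pi> * \<kappa> * e) = of_int \<sigma> * (\<pi> * e)
        + (of_int p * (qcnj (e * z) * \<kappa> * e) - of_int (qnorm e) * (\<pi> * qcnj (z * \<pi> * \<kappa>)))"
        by (simp add: algebra_simps)
      have "coprime \<tau> p" using z p(1) by (metis \<tau>_def coprime_commute prime_imp_coprime)
      then obtain c where c: "[\<tau> * c = 1] (mod p)" using cong_solve_coprime_int by blast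
      define s where "s = (- \<sigma> * c) mod p"
      have "[\<tau> * s + \<sigma> = \<tau> * (- \<sigma> * c) + \<sigma>] (mod p)"
        unfolding s_def by (intro cong_add cong_mult) auto
      also have "\<tau> * (- \<sigma> * c) + \<sigma> = - \<sigma> * (\<tau> * c) + \<sigma>" by (simp add: algebra_simps)
      also have "[- \<sigma> * (\<tau> * c) + \<sigma> = - \<sigma> * 1 + \<sigma>] (mod p)"
        by (intro cong_add cong_mult c) auto
      finally have s: "p dvd \<tau> * s + \<sigma>" by (simp add: cong_0_iff)
      have s_range: "0 \<le> s" "s < p" using p0 by (auto simp: s_def)
      have "of_int \<tau> * (of_int s * (\<pi> * e) + \<pi> * \<kappa> * e)
          = of_int (\<tau> * s) * (\<pi> * e) + of_int \<tau> * (\<pi> * \<kappa> * e)"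
        by (simp add: distrib_left mult.assoc)
      also have "\<dots> = of_int (\<tau> * s + \<sigma>) * (\<pi> * e)
        + (of_int p * (qcnj (e * z) * \<kappa> * e) - of_int (qnorm e) * (\<pi> * qcnj (z * \<pi> * \<kappa>)))"
        unfolding 3 of_int_add_mult_iquat by (simp add: add.assoc)
      also have "qdvd p \<dots>"
        by (intro qdvd_add qdvd_diff qdvd_of_int_mult s e_norm dvd_refl)
      finally have "qdvd p (of_int s * (\<pi> * e) + \<pi> * \<kappa> * e)"
        using qdvd_of_int_mult_prime[OF p(1) z] unfolding \<tau>_def by blast
      hence "\<pi> \<in> annihilators p (l s)" using s_range n by (auto simp: annihilators_def l_def split)
      thus ?thesis using s_range by auto
    qed
  qed (auto simp: annihilators_def)
  have disj: "annihilators p (l s) \<inter> annihilators p (l t) = {}" if "s \<in> {0..p}" "t \<in> {0..p}" "s < t" for s t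
  proof (rule ccontr)
    assume "annihilators p (l s) \<inter> annihilators p (l t) \<noteq> {}"
    then obtain \<pi> where n: "qnorm \<pi> = p" and *: "qdvd p (\<pi> * l s)" "qdvd p (\<pi> * l t)"
      by (auto simp: annihilators_def)
    have s: "qdvd p (of_int s * (\<pi> * e) + \<pi> * \<kappa> * e)" using *(1) that by (simp add: l_def split)
    have e: "qdvd p (\<pi> * e)"
    proof (cases "t = p")
      case True
      thus ?thesis using * by (simp add: l_def)
    next
      case False
      hence "qdvd p (of_int t * (\<pi> * e) + \<pi> * \<kappa> * e)" using * by (simp add: l_def split)
      from qdvd_diff[OF this s] have "qdvd p (of_int (t - s) * (\<pi> * e))" by (simp add: algebra_simps)
      moreover have "\<not> p dvd t - s" using that False by (auto dest: zdvd_imp_le)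
      ultimately show ?thesis using qdvd_of_int_mult_prime[OF p(1)] by blast
    qed
    have "qdvd p (\<pi> * \<kappa> * e)"
      using qdvd_diff[OF s qdvd_mult_left[OF e, of "of_int s"]] by simp
    with not_both n e show False by blast
  qed
  have "card {\<pi>. qnorm \<pi> = p} = (\<Sum>s\<in>{0..p}. card (annihilators p (l s)))"
    unfolding cover
  proof (rule card_UN_disjoint)
    show "\<forall>s\<in>{0..p}. \<forall>t\<in>{0..p}. s \<noteq> t \<longrightarrow> annihilators p (l s) \<inter> annihilators p (l t) = {}"
      using disj by (metis inf_commute linorder_neqE)
  qed auto
  also have "\<dots> = 8 * nat (p + 1)"
    using card_annihilators[OF p l_ok] by simp
  finally show ?thesis .
qed

section \<open>Double counting for sums of four squares\<close>

lemma card_qnorm_annihilated_by: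
  assumes p0: "p > 0" and \<pi>: "qnorm \<pi> = p"
  shows "card {x \<in> {x. qnorm x = p * n}. qdvd p (\<pi> * x)} = card {y. qnorm y = n}"
proof -
  \<comment> \<open>If \<open>\<pi> * x\<close> is \<open>p\<close> times \<open>y\<close>, left
    multiplication by \<open>qcnj \<pi>\<close> and cancelling \<open>p\<close> give
    \<open>x = qcnj \<pi> * y\<close>.\<close>
  have "{x \<in> {x. qnorm x = p * n}. qdvd p (\<pi> * x)} = (*) (qcnj \<pi>) ` {y. qnorm y = n}"
  proof (intro equalityI subsetI)
    fix x assume "x \<in> {x \<in> {x. qnorm x = p * n}. qdvd p (\<pi> * x)}"
    then obtain y where x: "qnorm x = p * n" and y: "\<pi> * x = of_int p * y"
      by (auto simp: qdvd_def)
    have "of_int p * (qcnj \<pi> * y) = qcnj \<pi> * \<pi> * x"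
      by (simp add: mult.assoc y of_int_iquat_left_commute)
    hence x_eq: "x = qcnj \<pi> * y"
      using p0 \<pi> of_int_mult_cancel_iquat[of p] by (simp add: qcnj_mult_self)
    have "qnorm y = n" using x p0 \<pi> by (simp add: x_eq qnorm_mult)
    thus "x \<in> (*) (qcnj \<pi>) ` {y. qnorm y = n}" using x_eq by blast
  next
    fix x assume "x \<in> (*) (qcnj \<pi>) ` {y. qnorm y = n}"
    then obtain y where y: "x = qcnj \<pi> * y" "qnorm y = n" by blast
    have "\<pi> * x = of_int p * y" by (simp add: y \<pi> mult_qcnj_self mult.assoc[symmetric])
    thus "x \<in> {x \<in> {x. qnorm x = p * n}. qdvd p (\<pi> * x)}"
      using y \<pi> by (simp add: qnorm_mult qdvd_of_int_mult)
  qed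
  moreover have "inj_on ((*) (qcnj \<pi>)) {y. qnorm y = n}"
  proof (rule inj_onI)
    fix y z assume "qcnj \<pi> * y = qcnj \<pi> * z"
    hence "\<pi> * qcnj \<pi> * y = \<pi> * qcnj \<pi> * z" by (simp add: mult.assoc)
    thus "y = z" using p0 \<pi> of_int_mult_cancel_iquat[of p] by (simp add: mult_qcnj_self)
  qed
  ultimately show ?thesis by (simp add: card_image)
qed

text \<open>Count the pairs of \<open>\<pi>\<close> of norm \<open>p\<close> and \<open>x\<close> of
  norm \<open>p * n\<close> with \<open>p\<close> dividing \<open>\<pi> * x\<close>. Each of the
  \<open>8 * (p + 1)\<close> choices of \<open>\<pi>\<close> admits as many \<open>x\<close> as
  there are quaternions of norm \<open>n\<close>; each \<open>x\<close> admits 8 choices of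
  \<open>\<pi>\<close>, or all of them if \<open>p\<close> divides \<open>x\<close>.\<close>

lemma card_qnorm_mult_prime:
  assumes p: "prime (p::int)" "odd p"
  shows "nat (p + 1) * card {x. qnorm x = n}
    = card {x. qnorm x = p * n} + nat p * card {x. qnorm x = p * n \<and> qdvd p x}"
proof -
  have p0: "p > 0" using p by (simp add: prime_gt_0_int)
  define P where "P = {\<pi>. qnorm \<pi> = p}"
  define R where "R = {x. qnorm x = p * n}"
  have fin: "finite P" "finite R" unfolding P_def R_def by (rule finite_qnorm_eq)+
  have "card {\<pi> \<in> P. qdvd p (\<pi> * x)} = 8 + (if qdvd p x then 8 * nat p else 0)"
    if x: "x \<in> R" for x
  proof (cases "qdvd p x")
    case True
    hence "{\<pi> \<in> P. qdvd p (\<pi> * x)} = {\<pi>. qnorm \<pi> = p}"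
      by (simp add: P_def qdvd_mult_left)
    thus ?thesis using True p0 by (simp add: card_qnorm_eq_prime[OF p] nat_add_distrib)
  next
    case False
    thus ?thesis using x card_annihilators[OF p, of x] by (simp add: R_def P_def annihilators_def)
  qed
  hence "(\<Sum>\<pi>\<in>P. card {x \<in> R. qdvd p (\<pi> * x)}) = (\<Sum>x\<in>R. 8 + (if qdvd p x then 8 * nat p else 0))"
    using fin by (intro sum_multicount_gen) auto
  also have "\<dots> = 8 * card R + (\<Sum>x\<in>R. if qdvd p x then 8 * nat p else 0)"
    by (simp add: sum.distrib)
  also have "(\<Sum>x\<in>R. if qdvd p x then 8 * nat p else 0) = (\<Sum>x\<in>{x\<in>R. qdvd p x}. 8 * nat p)"
    by (rule sum.inter_filter[OF fin(2), symmetric])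
  also have "(\<Sum>\<pi>\<in>P. card {x \<in> R. qdvd p (\<pi> * x)}) = card P * card {y. qnorm y = n}"
    using card_qnorm_annihilated_by[OF p0] by (simp add: P_def R_def)
  finally have "8 * (nat (p + 1) * card {y. qnorm y = n}) = 8 * (card R + nat p * card {x\<in>R. qdvd p x})"
    unfolding P_def card_qnorm_eq_prime[OF p] by (simp add: mult_ac)
  thus ?thesis by (simp add: R_def)
qed

text \<open>For \<open>p = 5\<close> the factor \<open>p + 1\<close> is 1 modulo 5 and the
  correction term vanishes.\<close>

lemma card_four_squares_5:
  "[card {x. qnorm x = 5 * n} = card {x. qnorm x = n}] (mod 5)"
proof -
  have *: "b mod 5 = a mod 5" if "6 * a = b + 5 * c" for a b c :: nat
  proof -
    have "(b + 5 * c) mod 5 = (a + 5 * a) mod 5" by (simp flip: that)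
    thus ?thesis by (simp only: mod_mult_self2)
  qed
  have "prime (5::int)" "odd (5::int)" by simp_all
  from card_qnorm_mult_prime[OF this, of n]
  have "6 * card {x. qnorm x = n}
      = card {x. qnorm x = 5 * n} + 5 * card {x. qnorm x = 5 * n \<and> qdvd 5 x}"
    by (simp only: nat_numeral add_numeral_left numeral_plus_one semiring_norm)
  thus ?thesis unfolding cong_def by (rule *)
qed

section \<open>Sums of three squares\<close>

text \<open>Encodes the representations of \<open>n\<close> as a sum of three squares so that
  quaternion conjugation can act on them.\<close>

definition pure_quats :: "int \<Rightarrow> iquat set" where
  "pure_quats n = {x. q0 x = 0 \<and> qnorm x = n}"

lemma finite_pure_quats [simp]: "finite (pure_quats n)"
  by (rule finite_subset[OF _ finite_qnorm_eq[of n]]) (auto simp: pure_quats_def)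

section \<open>Conjugation of pure quaternions\<close>

lemma qcnj_pure: "q0 x = 0 \<Longrightarrow> qcnj x = - x"
  by (rule iquat_eqI) simp_all

lemma q0_conjugate: "q0 (a * x * qcnj a) = qnorm a * q0 x"
  by (simp add: iquat_sel_times qnorm_def power2_eq_square algebra_simps)

lemma qdvd_of_int_mult_coprime:
  "coprime t m \<Longrightarrow> qdvd m (of_int t * x) \<longleftrightarrow> qdvd m x"
  by (auto simp: qdvd_iff coprime_dvd_mult_right_iff coprime_commute)

text \<open>From left to right, multiply by \<open>\<pi>\<close> on the right and cancel
  \<open>p\<close>. Conversely, \<open>y\<close> being pure, \<open>p\<close> divides both
  \<open>\<pi> * y\<close> and \<open>y * qcnj \<pi>\<close>. If the trace \<open>t\<close> of
  \<open>y * z\<close> is prime to \<open>p\<close>, then \<open>t * y\<close> is congruent to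
  \<open>y * z * y\<close> modulo \<open>p ^ 2\<close>, so \<open>t\<close> times the conjugate is
  congruent to \<open>(\<pi> * y) * z * (y * qcnj \<pi>)\<close>.\<close>

lemma qdvd_sq_conjugate_iff:
  assumes p: "prime (p::int)" "odd p" and \<pi>: "qnorm \<pi> = p"
    and y: "q0 y = 0" "\<not> qdvd p y" "p ^ 2 dvd qnorm y"
  shows "qdvd (p ^ 2) (\<pi> * y * qcnj \<pi>) \<longleftrightarrow> qdvd p (\<pi> * y)"
proof
  have p0: "p \<noteq> 0" using p by auto
  assume "qdvd (p ^ 2) (\<pi> * y * qcnj \<pi>)"
  then obtain w where w: "\<pi> * y * qcnj \<pi> = of_int (p ^ 2) * w" by (auto simp: qdvd_def)
  have "of_int p * (\<pi> * y) = \<pi> * y * (qcnj \<pi> * \<pi>)"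
    by (simp only: qcnj_mult_self \<pi> of_int_iquat_commute[of "\<pi> * y"])
  also have "\<dots> = \<pi> * y * qcnj \<pi> * \<pi>" by (simp only: mult.assoc)
  also have "\<dots> = of_int p * (of_int p * (w * \<pi>))"
    unfolding w by (simp add: power2_eq_square mult.assoc)
  finally have "\<pi> * y = of_int p * (w * \<pi>)" using of_int_mult_cancel_iquat[OF p0] by blast
  thus "qdvd p (\<pi> * y)" by (auto simp: qdvd_def)
next
  assume "qdvd p (\<pi> * y)"
  then obtain w where w: "\<pi> * y = of_int p * w" by (auto simp: qdvd_def)
  have w': "y * qcnj \<pi> = - (of_int p * qcnj w)"
    using arg_cong[OF w, of qcnj] by (simp add: qcnj_mult qcnj_pure y of_int_iquat_commute)
       (metis minus_equation_iff)
  obtain z where z: "\<not> p dvd 2 * q0 (y * z)" using ex_trace_not_dvd[OF p y(2)] by blast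
  define t where "t = 2 * q0 (y * z)"
  have "of_int t * y = y * z * y + of_int (qnorm y) * qcnj z"
    unfolding t_def by (subst mult_sandwich) simp
  hence "of_int t * (\<pi> * y * qcnj \<pi>) = \<pi> * (y * z * y + of_int (qnorm y) * qcnj z) * qcnj \<pi>"
    by (metis mult.assoc of_int_iquat_left_commute)
  also have "\<dots> = (\<pi> * y) * z * (y * qcnj \<pi>) + of_int (qnorm y) * (\<pi> * qcnj z * qcnj \<pi>)"
    by (simp add: distrib_left distrib_right mult.assoc of_int_iquat_left_commute)
  also have "(\<pi> * y) * z * (y * qcnj \<pi>) = of_int (p ^ 2) * (- (w * z * qcnj w))"
    by (simp add: w w' mult.assoc power2_eq_square
        of_int_iquat_left_commute[of w] of_int_iquat_left_commute[of z])
  also have "qdvd (p ^ 2) (\<dots> + of_int (qnorm y) * (\<pi> * qcnj z * qcnj \<pi>))"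
    by (intro qdvd_add qdvd_of_int_mult y dvd_refl)
  finally have "qdvd (p ^ 2) (of_int t * (\<pi> * y * qcnj \<pi>))" .
  moreover have "coprime t (p ^ 2)"
    using z p(1) by (metis t_def coprime_commute coprime_power_right_iff prime_imp_coprime)
  ultimately show "qdvd (p ^ 2) (\<pi> * y * qcnj \<pi>)" using qdvd_of_int_mult_coprime by blast
qed

text \<open>Let \<open>a = \<pi> * z\<close>. As \<open>z\<close> is pure, \<open>z * z\<close> is
  minus its norm, so \<open>a * z\<close> vanishes modulo \<open>p\<close>. If \<open>a\<close> did
  not vanish, some trace \<open>t\<close> of \<open>a * x\<close> would be prime to
  \<open>p\<close>, with \<open>t * a\<close> congruent to \<open>a * x * \<pi> * z\<close>.
  Replacing \<open>x * \<pi>\<close> by its trace minus its conjugate leaves multiples of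
  \<open>a * z\<close> and \<open>a * qcnj \<pi>\<close>, which both vanish.\<close>

lemma qdvd_conjugate_iff:
  assumes p: "prime (p::int)" "odd p" and \<pi>: "qnorm \<pi> = p"
    and z: "q0 z = 0" "p dvd qnorm z"
  shows "qdvd p (\<pi> * z * qcnj \<pi>) \<longleftrightarrow> qdvd p (\<pi> * z)"
proof
  assume *: "qdvd p (\<pi> * z * qcnj \<pi>)"
  define a where "a = \<pi> * z"
  have az: "qdvd p (a * z)"
  proof -
    have "z * z = - of_int (qnorm z)"
      using mult_qcnj_self[of z] z by (simp add: qcnj_pure) (metis minus_equation_iff)
    hence "a * z = - (of_int (qnorm z) * \<pi>)" by (simp add: a_def mult.assoc of_int_iquat_commute)
    thus ?thesis using z by (simp add: qdvd_of_int_mult)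
  qed
  show "qdvd p (\<pi> * z)"
  proof (rule ccontr)
    assume "\<not> qdvd p (\<pi> * z)"
    hence a: "\<not> qdvd p a" by (simp add: a_def)
    obtain x where x: "\<not> p dvd 2 * q0 (a * x)" using ex_trace_not_dvd[OF p a] by blast
    have "of_int (2 * q0 (a * x)) * a = a * x * a + of_int (qnorm a) * qcnj x"
      by (subst mult_sandwich) simp
    also have "a * x * a = a * (x * \<pi>) * z" by (simp add: a_def mult.assoc)
    also have "x * \<pi> = of_int (2 * q0 (x * \<pi>)) - qcnj \<pi> * qcnj x"
      by (subst mult_plus_qcnj[symmetric]) simp
    also have "a * (of_int (2 * q0 (x * \<pi>)) - qcnj \<pi> * qcnj x) * z
        = of_int (2 * q0 (x * \<pi>)) * (a * z) - (a * qcnj \<pi>) * (qcnj x * z)"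
      by (simp only: right_diff_distrib left_diff_distrib mult.assoc of_int_iquat_left_commute)
    also have "qdvd p (\<dots> + of_int (qnorm a) * qcnj x)"
      using * az \<pi> unfolding a_def
      by (intro qdvd_add qdvd_diff qdvd_mult_left[OF az[unfolded a_def]]
          qdvd_mult_right[OF *] qdvd_of_int_mult) (simp add: qnorm_mult)
    finally have "qdvd p (of_int (2 * q0 (a * x)) * a)" .
    thus False using a x qdvd_of_int_mult_prime[OF p(1)] by blast
  qed
qed (rule qdvd_mult_right)

text \<open>If \<open>\<pi> * y * qcnj \<pi>\<close> is \<open>p ^ 2\<close> times \<open>x\<close>,
  multiplying by \<open>qcnj \<pi>\<close> on the left and \<open>\<pi>\<close> on the right gives
  \<open>y = qcnj \<pi> * x * \<pi>\<close>; so the set is an injective image of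
  \<open>pure_quats n\<close>.\<close>

lemma card_pure_conjugated_by:
  assumes p0: "p > 0" and \<pi>: "qnorm \<pi> = p"
  shows "card {y \<in> pure_quats (p ^ 2 * n). qdvd (p ^ 2) (\<pi> * y * qcnj \<pi>)} = card (pure_quats n)"
proof -
  have "{y \<in> pure_quats (p ^ 2 * n). qdvd (p ^ 2) (\<pi> * y * qcnj \<pi>)}
    = (\<lambda>x. qcnj \<pi> * x * \<pi>) ` pure_quats n" (is "?L = ?R")
  proof (intro equalityI subsetI)
    fix y assume "y \<in> ?L"
    then obtain x where y: "q0 y = 0" "qnorm y = p ^ 2 * n"
      and x: "\<pi> * y * qcnj \<pi> = of_int (p ^ 2) * x"
      by (auto simp: qdvd_def pure_quats_def)
    have "of_int (p ^ 2) * (qcnj \<pi> * x * \<pi>) = qcnj \<pi> * (of_int (p ^ 2) * x) * \<pi>"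
      by (simp only: mult.assoc of_int_iquat_left_commute)
    also have "\<dots> = (qcnj \<pi> * \<pi>) * y * (qcnj \<pi> * \<pi>)" by (simp only: x[symmetric] mult.assoc)
    also have "\<dots> = of_int (p ^ 2) * y"
      by (simp add: qcnj_mult_self \<pi> of_int_iquat_commute[of y] power2_eq_square mult.assoc)
    finally have y_eq: "y = qcnj \<pi> * x * \<pi>"
      using p0 of_int_mult_cancel_iquat[of "p ^ 2"] by simp
    have "p ^ 2 * q0 x = 0"
      using q0_conjugate[of \<pi> y] unfolding x y iquat_sel_of_int_times by simp
    moreover have "qnorm x = n"
      using y(2) p0 unfolding y_eq qnorm_mult qnorm_qcnj \<pi> by (simp add: power2_eq_square)
    ultimately have "x \<in> pure_quats n" using p0 by (simp add: pure_quats_def)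
    thus "y \<in> ?R" using y_eq by blast
  next
    fix y assume "y \<in> ?R"
    then obtain x where x: "y = qcnj \<pi> * x * \<pi>" "q0 x = 0" "qnorm x = n"
      by (auto simp: pure_quats_def)
    have "\<pi> * y * qcnj \<pi> = (\<pi> * qcnj \<pi>) * x * (\<pi> * qcnj \<pi>)" by (simp only: x mult.assoc)
    also have "\<dots> = of_int (p ^ 2) * x"
      by (simp add: mult_qcnj_self \<pi> of_int_iquat_commute[of x] power2_eq_square mult.assoc)
    finally have "qdvd (p ^ 2) (\<pi> * y * qcnj \<pi>)" by (auto simp: qdvd_def)
    moreover have "q0 y = 0" using q0_conjugate[of "qcnj \<pi>" x] x by simp
    ultimately show "y \<in> ?L" using x \<pi> by (simp add: pure_quats_def qnorm_mult power2_eq_square)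
  qed
  moreover have "inj_on (\<lambda>x. qcnj \<pi> * x * \<pi>) (pure_quats n)"
  proof (rule inj_onI)
    fix x y assume "qcnj \<pi> * x * \<pi> = qcnj \<pi> * y * \<pi>"
    hence "qcnj \<pi> * x = qcnj \<pi> * y" using iquat_mult_right_cancel \<pi> p0 by force
    hence "\<pi> * qcnj \<pi> * x = \<pi> * qcnj \<pi> * y" by (simp add: mult.assoc)
    thus "x = y" using p0 \<pi> of_int_mult_cancel_iquat[of p] by (simp add: mult_qcnj_self)
  qed
  ultimately show ?thesis by (simp add: card_image)
qed

text \<open>Count the pairs of \<open>\<pi>\<close> and \<open>y\<close> with \<open>p ^ 2\<close>
  dividing \<open>\<pi> * y * qcnj \<pi>\<close>. Every \<open>\<pi>\<close> is admissible if
  \<open>p ^ 2\<close> divides \<open>y\<close>. Otherwise exactly 8 are: the annihilators of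
  \<open>y\<close> if \<open>p\<close> does not divide \<open>y\<close>, and those of
  \<open>z\<close> if \<open>y\<close> is \<open>p\<close> times \<open>z\<close>, where
  \<open>p dvd n\<close> makes the norm of \<open>z\<close> divisible by \<open>p\<close>.\<close>

lemma card_pure_mult_prime_sq:
  assumes p: "prime (p::int)" "odd p" and n: "p dvd n"
  shows "nat (p + 1) * card (pure_quats n)
    = card (pure_quats (p ^ 2 * n)) + nat p * card {y \<in> pure_quats (p ^ 2 * n). qdvd (p ^ 2) y}"
proof -
  have p0: "p > 0" using p by (simp add: prime_gt_0_int)
  define P where "P = {\<pi>. qnorm \<pi> = p}"
  define R where "R = pure_quats (p ^ 2 * n)"
  have fin: "finite P" "finite R" unfolding P_def R_def by (simp_all add: finite_qnorm_eq)
  have "card {\<pi> \<in> P. qdvd (p ^ 2) (\<pi> * y * qcnj \<pi>)} = 8 + (if qdvd (p ^ 2) y then 8 * nat p else 0)"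
    if "y \<in> R" for y
  proof -
    have y: "q0 y = 0" "qnorm y = p ^ 2 * n" using that by (auto simp: R_def pure_quats_def)
    consider "qdvd (p ^ 2) y" | "qdvd p y" "\<not> qdvd (p ^ 2) y" | "\<not> qdvd p y" by blast
    thus ?thesis
    proof cases
      case 1
      hence "{\<pi> \<in> P. qdvd (p ^ 2) (\<pi> * y * qcnj \<pi>)} = {\<pi>. qnorm \<pi> = p}"
        by (simp add: P_def qdvd_mult_left qdvd_mult_right)
      thus ?thesis using 1 p0 by (simp add: card_qnorm_eq_prime[OF p] nat_add_distrib)
    next
      case 2
      then obtain z where z: "y = of_int p * z" by (auto simp: qdvd_def)
      have z': "q0 z = 0" "qnorm z = n" using y p0 by (simp_all add: z qnorm_mult)
      have nz: "\<not> qdvd p z"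
        using 2(2) qdvd_of_int_mult_cancel[of p p z] p0 by (simp add: z power2_eq_square)
      have "qdvd (p ^ 2) (\<pi> * y * qcnj \<pi>) \<longleftrightarrow> qdvd p (\<pi> * z)" if "qnorm \<pi> = p" for \<pi>
      proof -
        have "\<pi> * y * qcnj \<pi> = of_int p * (\<pi> * z * qcnj \<pi>)"
          by (simp only: z mult.assoc of_int_iquat_left_commute)
        hence "qdvd (p ^ 2) (\<pi> * y * qcnj \<pi>) \<longleftrightarrow> qdvd p (\<pi> * z * qcnj \<pi>)"
          using qdvd_of_int_mult_cancel[of p p "\<pi> * z * qcnj \<pi>"] p0 by (simp add: power2_eq_square)
        thus ?thesis using qdvd_conjugate_iff[OF p that z'(1)] z'(2) n by simp
      qed
      hence "{\<pi> \<in> P. qdvd (p ^ 2) (\<pi> * y * qcnj \<pi>)} = annihilators p z"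
        by (auto simp: P_def annihilators_def)
      thus ?thesis using card_annihilators[OF p nz] z' n 2 by simp
    next
      case 3
      have "\<not> qdvd (p ^ 2) y" using 3 by (auto simp: qdvd_iff power2_eq_square dest: dvd_mult_left)
      moreover have "{\<pi> \<in> P. qdvd (p ^ 2) (\<pi> * y * qcnj \<pi>)} = annihilators p y"
        using qdvd_sq_conjugate_iff[OF p _ y(1) 3] y(2) by (auto simp: P_def annihilators_def)
      ultimately show ?thesis using card_annihilators[OF p 3] y(2) by (simp add: power2_eq_square)
    qed
  qed
  hence "(\<Sum>\<pi>\<in>P. card {y \<in> R. qdvd (p ^ 2) (\<pi> * y * qcnj \<pi>)})
      = (\<Sum>y\<in>R. 8 + (if qdvd (p ^ 2) y then 8 * nat p else 0))"
    using fin by (intro sum_multicount_gen) auto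
  also have "\<dots> = 8 * card R + (\<Sum>y\<in>R. if qdvd (p ^ 2) y then 8 * nat p else 0)"
    by (simp add: sum.distrib)
  also have "(\<Sum>y\<in>R. if qdvd (p ^ 2) y then 8 * nat p else 0) = (\<Sum>y\<in>{y\<in>R. qdvd (p ^ 2) y}. 8 * nat p)"
    by (rule sum.inter_filter[OF fin(2), symmetric])
  also have "(\<Sum>\<pi>\<in>P. card {y \<in> R. qdvd (p ^ 2) (\<pi> * y * qcnj \<pi>)}) = card P * card (pure_quats n)"
    using card_pure_conjugated_by[OF p0] by (simp add: P_def R_def)
  finally have "8 * (nat (p + 1) * card (pure_quats n))
      = 8 * (card R + nat p * card {y\<in>R. qdvd (p ^ 2) y})"
    unfolding P_def card_qnorm_eq_prime[OF p] by (simp add: mult_ac)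
  thus ?thesis by (simp add: R_def)
qed

lemma card_pure_qdvd:
  assumes "m \<noteq> 0"
  shows "card {y \<in> pure_quats (m ^ 2 * n). qdvd m y} = card (pure_quats n)"
proof -
  have "{y \<in> pure_quats (m ^ 2 * n). qdvd m y} = (*) (of_int m) ` pure_quats n"
    using assms by (auto simp: pure_quats_def qdvd_def qnorm_mult)
  moreover have "inj_on ((*) (of_int m)) (pure_quats n)"
    using of_int_mult_cancel_iquat[OF assms] by (auto intro: inj_onI)
  ultimately show ?thesis by (simp add: card_image)
qed

text \<open>With \<open>a k\<close> the count for exponent \<open>2 * k + 1\<close>, the recursion
  makes each difference \<open>a (k + 1) - a k\<close> equal to \<open>p\<close> times the preceding
  one. At the start \<open>a 1 - a 0\<close> is \<open>p * a 0\<close>, because a quaternion of norm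
  \<open>p ^ 3 * N\<close> divisible by \<open>p ^ 2\<close> would force \<open>p\<close> to divide
  \<open>N\<close>.\<close>

lemma card_pure_prime_power:
  fixes p N :: int
  assumes p: "prime p" "odd p" and N: "\<not> p dvd N"
  shows "card (pure_quats (p ^ (2 * k + 1) * N)) = (\<Sum>i\<le>k. nat p ^ i) * card (pure_quats (p * N))"
proof -
  have p0: "p > 0" using p by (simp add: prime_gt_0_int)
  define a where "a k = card (pure_quats (p ^ (2 * k + 1) * N))" for k
  have a1: "nat (p + 1) * a 0 = a 1"
  proof -
    have "\<not> qdvd (p ^ 2) y" if "y \<in> pure_quats (p ^ 2 * (p * N))" for y
    proof
      assume "qdvd (p ^ 2) y"
      hence "(p ^ 2) ^ 2 dvd p ^ 2 * (p * N)"
        using that qdvd_imp_dvd_qnorm[of "p ^ 2" y] by (simp add: pure_quats_def)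
      hence "p dvd N" using p0 by (simp add: power2_eq_square mult.assoc)
      with N show False by simp
    qed
    hence "{y \<in> pure_quats (p ^ 2 * (p * N)). qdvd (p ^ 2) y} = {}" by blast
    thus ?thesis using card_pure_mult_prime_sq[OF p, of "p * N"]
      by (simp add: a_def power3_eq_cube power2_eq_square numeral_3_eq_3 mult.assoc)
  qed
  have rec: "nat (p + 1) * a (Suc k) = a (Suc (Suc k)) + nat p * a k" for k
  proof -
    let ?n = "p ^ (2 * k + 1) * N"
    have eq: "p ^ (2 * Suc k + 1) * N = p ^ 2 * ?n" "p ^ (2 * Suc (Suc k) + 1) * N = p ^ 2 * (p ^ 2 * ?n)"
      "p ^ 2 * (p ^ 2 * ?n) = (p ^ 2) ^ 2 * ?n"
      by (simp_all add: power2_eq_square mult_ac)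
    have "card {y \<in> pure_quats (p ^ 2 * (p ^ 2 * ?n)). qdvd (p ^ 2) y} = card (pure_quats ?n)"
      unfolding eq(3) using p0 by (intro card_pure_qdvd) auto
    with card_pure_mult_prime_sq[OF p, of "p ^ 2 * ?n"] show ?thesis
      unfolding a_def eq(1,2) by (simp add: power2_eq_square)
  qed
  have step: "a (Suc k) = a k + nat p ^ Suc k * a 0" for k
  proof (induction k)
    case 0
    thus ?case using a1 p0 by (simp add: nat_add_distrib)
  next
    case (Suc k)
    have "a (Suc (Suc k)) + nat p * a k = nat (p + 1) * a (Suc k)" by (rule rec[symmetric])
    also have "\<dots> = a (Suc k) + nat p * a (Suc k)" using p0 by (simp add: nat_add_distrib)
    also have "nat p * a (Suc k) = nat p * a k + nat p ^ Suc (Suc k) * a 0"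
      unfolding Suc.IH by (simp add: algebra_simps)
    finally show ?case by simp
  qed
  have "a k = (\<Sum>i\<le>k. nat p ^ i) * a 0" for k
    by (induction k) (simp_all add: step algebra_simps)
  thus ?thesis by (simp add: a_def)
qed

section \<open>Overpartitions and Gauss' identity\<close>

unbundle fps_syntax

text \<open>Bounding the parts by \<open>m\<close> allows induction on the largest admissible part;
  for \<open>m \<ge> n\<close> nothing is lost.\<close>

definition bounded_overpartitions :: "nat \<Rightarrow> nat \<Rightarrow> (nat multiset \<times> nat set) set" where
  "bounded_overpartitions m n = {(M, S) \<in> overpartitions n. set_mset M \<subseteq> {..m}}"

lemma bounded_overpartitions_0:
  "bounded_overpartitions 0 n = (if n = 0 then {({#}, {})} else {})"
proof -
  have M: "M = {#}" if "\<forall>k\<in>#M. 0 < k" "set_mset M \<subseteq> {..0}" for M :: "nat multiset"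
    using that by (cases M) auto
  have "(M, S) \<in> bounded_overpartitions 0 n \<longleftrightarrow> M = {#} \<and> S = {} \<and> n = 0" for M S
    unfolding bounded_overpartitions_def overpartitions_def using M[of M] by auto
  thus ?thesis by auto
qed

text \<open>If \<open>Suc m\<close> occurs, remove one copy. The set \<open>S\<close> is kept when
  another copy remains or \<open>Suc m\<close> is not overlined; otherwise the only copy was
  overlined, and its mark goes with it, leaving parts at most \<open>m\<close>.\<close>

lemma bounded_overpartitions_Suc:
  "bounded_overpartitions (Suc m) n = bounded_overpartitions m n \<union>
     (if Suc m \<le> n then
       (\<lambda>(M, S). (add_mset (Suc m) M, S)) ` bounded_overpartitions (Suc m) (n - Suc m) \<union>
       (\<lambda>(M, S). (add_mset (Suc m) M, insert (Suc m) S)) ` bounded_overpartitions m (n - Suc m)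
      else {})" (is "?L = ?A \<union> (if _ then ?B \<union> ?C else {})")
proof (intro equalityI subsetI)
  fix x assume "x \<in> ?L"
  then obtain M S where x: "x = (M, S)" and MS: "\<forall>k\<in>#M. 0 < k" "sum_mset M = n" "S \<subseteq> set_mset M"
    "set_mset M \<subseteq> {..Suc m}" by (auto simp: bounded_overpartitions_def overpartitions_def)
  show "x \<in> ?A \<union> (if Suc m \<le> n then ?B \<union> ?C else {})"
  proof (cases "Suc m \<in># M")
    case False
    hence "set_mset M \<subseteq> {..m}" using MS(4) le_Suc_eq by auto
    thus ?thesis using MS x by (auto simp: bounded_overpartitions_def overpartitions_def)
  next
    case True
    then obtain M' where M': "M = add_mset (Suc m) M'" by (metis multi_member_split)
    have n: "Suc m \<le> n" "sum_mset M' = n - Suc m" using MS(2) M' by auto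
    show ?thesis
    proof (cases "Suc m \<in># M' \<or> Suc m \<notin> S")
      case True
      have "(M', S) \<in> bounded_overpartitions (Suc m) (n - Suc m)"
        using MS n True unfolding M' by (auto simp: bounded_overpartitions_def overpartitions_def)
      thus ?thesis using n(1) unfolding x M' by force
    next
      case False
      hence "set_mset M' \<subseteq> {..m}" using MS(4) le_Suc_eq unfolding M' by auto
      hence "(M', S - {Suc m}) \<in> bounded_overpartitions m (n - Suc m)"
        using MS n unfolding M' by (auto simp: bounded_overpartitions_def overpartitions_def)
      moreover have "S = insert (Suc m) (S - {Suc m})" using False by auto
      ultimately show ?thesis using n(1) unfolding x M' by force
    qed
  qed
qed (auto simp: bounded_overpartitions_def overpartitions_def split: if_splits)

lemma finite_bounded_overpartitions [simp]: "finite (bounded_overpartitions m n)"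
proof (induction m arbitrary: n)
  case (Suc m)
  note IH = this
  show ?case
  proof (induction n rule: less_induct)
    case (less n)
    thus ?case using IH by (subst bounded_overpartitions_Suc) auto
  qed
qed (simp add: bounded_overpartitions_0)

lemma card_bounded_overpartitions_Suc:
  "card (bounded_overpartitions (Suc m) n) = card (bounded_overpartitions m n) +
     (if Suc m \<le> n then card (bounded_overpartitions (Suc m) (n - Suc m))
        + card (bounded_overpartitions m (n - Suc m)) else 0)"
proof (cases "Suc m \<le> n")
  case True
  let ?f = "\<lambda>(M, S). (add_mset (Suc m) M, S)"
  let ?g = "\<lambda>(M, S). (add_mset (Suc m) M, insert (Suc m) S)"
  let ?A = "bounded_overpartitions m n"
  let ?B = "?f ` bounded_overpartitions (Suc m) (n - Suc m)"
  let ?C = "?g ` bounded_overpartitions m (n - Suc m)"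
  have "Suc m \<notin> S" "Suc m \<notin># M" if "(M, S) \<in> bounded_overpartitions m k" for M S k
    using that by (auto simp: bounded_overpartitions_def overpartitions_def)
  note notin = this
  have S_sub: "S \<subseteq> set_mset M" if "(M, S) \<in> bounded_overpartitions k l" for M S k l
    using that by (auto simp: bounded_overpartitions_def overpartitions_def)
  have "?B \<inter> ?C = {}"
    using notin(2) S_sub by fastforce
  moreover have "?A \<inter> (?B \<union> ?C) = {}" using notin(2) by fastforce
  moreover have "inj_on ?g (bounded_overpartitions m (n - Suc m))"
    using notin(1) by (auto simp: inj_on_def) (metis insert_ident)+
  moreover have "inj_on ?f (bounded_overpartitions (Suc m) (n - Suc m))"
    by (auto simp: inj_on_def)
  ultimately show ?thesis using True
    by (subst bounded_overpartitions_Suc) (simp add: card_Un_disjoint card_image)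
qed (subst bounded_overpartitions_Suc, simp)

definition bounded_overpartition_fps :: "nat \<Rightarrow> int fps" where
  "bounded_overpartition_fps m = Abs_fps (\<lambda>n. int (card (bounded_overpartitions m n)))"

lemma bounded_overpartition_fps_0: "bounded_overpartition_fps 0 = 1"
  by (rule fps_ext) (simp add: bounded_overpartition_fps_def bounded_overpartitions_0)

text \<open>The factor \<open>(1 + q^(m+1)) / (1 - q^(m+1))\<close> of the product formula, written
  without division.\<close>

lemma bounded_overpartition_fps_Suc:
  "bounded_overpartition_fps (Suc m) = bounded_overpartition_fps m
     + fps_X ^ Suc m * (bounded_overpartition_fps (Suc m) + bounded_overpartition_fps m)"
proof (rule fps_ext)
  fix n
  show "bounded_overpartition_fps (Suc m) $ n = (bounded_overpartition_fps m
     + fps_X ^ Suc m * (bounded_overpartition_fps (Suc m) + bounded_overpartition_fps m)) $ n"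
    using card_bounded_overpartitions_Suc[of m n]
    by (simp add: bounded_overpartition_fps_def fps_X_power_mult_nth not_less del: power_Suc)
qed

lemma card_bounded_overpartitions_eq:
  assumes "n \<le> m"
  shows "card (bounded_overpartitions m n) = overpartition_count n"
proof -
  have "k \<le> sum_mset M" if "k \<in># M" for k and M :: "nat multiset"
    using multi_member_split[OF that] by auto
  hence "bounded_overpartitions m n = overpartitions n"
    using assms by (fastforce simp: bounded_overpartitions_def overpartitions_def)
  thus ?thesis by (simp add: overpartition_count_def)
qed

text \<open>With \<open>a s\<close> the generating function for parts up to \<open>s\<close>, this
  is the sum of \<open>(-1)^s (a s + a (s-1)) q^(s n)\<close> over
  \<open>1 \<le> s \<le> m\<close>.\<close>

definition gauss_tail :: "nat \<Rightarrow> nat \<Rightarrow> int fps" where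
  "gauss_tail m n = (\<Sum>s<m. (-1) ^ Suc s * (bounded_overpartition_fps (Suc s) + bounded_overpartition_fps s)
     * fps_X ^ (Suc s * n))"

text \<open>For \<open>Y = q^(m+1)\<close> the recursion reads \<open>Y * (a' + a) = a' - a\<close>,
  which turns the summand added in the induction step into the difference of two consecutive
  boundary terms.\<close>

lemma gauss_tail_telescope:
  "(1 - fps_X ^ n) * gauss_tail m (Suc n) - (1 + fps_X ^ n) * gauss_tail m n
     = 2 * fps_X ^ n - 2 * (-1) ^ m * fps_X ^ (Suc m * n) * bounded_overpartition_fps m"
proof (induction m)
  case 0
  thus ?case by (simp add: gauss_tail_def bounded_overpartition_fps_0)
next
  case (Suc m)
  define a a' where "a = bounded_overpartition_fps m" and "a' = bounded_overpartition_fps (Suc m)"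
  define Y Q Z \<epsilon> :: "int fps" where "Y = fps_X ^ Suc m" and "Q = fps_X ^ n"
    and "Z = fps_X ^ (Suc m * n)" and "\<epsilon> = (-1) ^ m"
  have a': "a' = a + Y * (a' + a)"
    unfolding a_def a'_def Y_def by (rule bounded_overpartition_fps_Suc)
  have pow: "fps_X ^ (Suc m * Suc n) = Z * Y" "fps_X ^ (Suc (Suc m) * n) = Z * Q"
    by (simp_all add: Z_def Y_def Q_def power_add mult_ac)
  have tail: "gauss_tail (Suc m) k = gauss_tail m k - \<epsilon> * (a' + a) * fps_X ^ (Suc m * k)" for k
    by (simp add: gauss_tail_def a_def a'_def \<epsilon>_def)
  have IH: "(1 - Q) * gauss_tail m (Suc n) - (1 + Q) * gauss_tail m n = 2 * Q - 2 * \<epsilon> * Z * a"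
    using Suc.IH by (simp add: Q_def \<epsilon>_def Z_def a_def)
  have "(1 - Q) * (\<epsilon> * (a' + a) * (Z * Y)) - (1 + Q) * (\<epsilon> * (a' + a) * Z)
      = \<epsilon> * Z * ((1 - Q) * (Y * (a' + a)) - (1 + Q) * (a' + a))" by (simp add: algebra_simps)
  also have "Y * (a' + a) = a' - a" using a' by (simp add: algebra_simps)
  also have "\<epsilon> * Z * ((1 - Q) * (a' - a) - (1 + Q) * (a' + a)) = - 2 * \<epsilon> * Z * a - 2 * \<epsilon> * (Z * Q) * a'"
    by (simp add: algebra_simps)
  finally have step: "(1 - Q) * (\<epsilon> * (a' + a) * (Z * Y)) - (1 + Q) * (\<epsilon> * (a' + a) * Z)
      = - 2 * \<epsilon> * Z * a - 2 * \<epsilon> * (Z * Q) * a'" .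
  have "(1 - Q) * gauss_tail (Suc m) (Suc n) - (1 + Q) * gauss_tail (Suc m) n
      = ((1 - Q) * gauss_tail m (Suc n) - (1 + Q) * gauss_tail m n)
        - ((1 - Q) * (\<epsilon> * (a' + a) * (Z * Y)) - (1 + Q) * (\<epsilon> * (a' + a) * Z))"
    unfolding tail pow Z_def[symmetric] by (simp only: algebra_simps)
  also have "\<dots> = 2 * Q + 2 * \<epsilon> * (Z * Q) * a'"
    unfolding IH step by (simp add: algebra_simps)
  finally have "(1 - Q) * gauss_tail (Suc m) (Suc n) - (1 + Q) * gauss_tail (Suc m) n
      = 2 * Q + 2 * \<epsilon> * (Z * Q) * a'" .
  thus ?case unfolding pow by (simp add: Q_def \<epsilon>_def a'_def)
qed

text \<open>A partial sum of \<open>\<phi>(-q)\<close>.\<close>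

definition gauss_sum :: "nat \<Rightarrow> int fps" where
  "gauss_sum n = (\<Sum>j\<in>{- int n..int n}. (-1) ^ nat (j ^ 2) * fps_X ^ nat (j ^ 2))"

lemma gauss_sum_Suc:
  "gauss_sum (Suc n) = gauss_sum n + 2 * (-1) ^ Suc n * fps_X ^ (Suc n * Suc n)"
proof -
  define h :: "int \<Rightarrow> int fps" where "h j = (-1) ^ nat (j ^ 2) * fps_X ^ nat (j ^ 2)" for j
  have "{- int (Suc n)..int (Suc n)} = insert (- int (Suc n)) (insert (int (Suc n)) {- int n..int n})"
    by auto
  hence "sum h {- int (Suc n)..int (Suc n)}
      = h (- int (Suc n)) + (h (int (Suc n)) + sum h {- int n..int n})" by simp
  moreover have "nat ((int (Suc n)) ^ 2) = Suc n * Suc n"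
    by (metis nat_int of_nat_mult power2_eq_square)
  moreover have "(-1 :: int fps) ^ (Suc n * Suc n) = (-1) ^ Suc n"
    by (simp add: minus_one_power_iff)
  ultimately show ?thesis unfolding gauss_sum_def h_def power2_minus by simp
qed

text \<open>A finite form of Gauss' identity in the manner of Shanks, multiplied through by
  \<open>\<Prod>k\<le>n. (1 + q\<^sup>k) / (1 - q\<^sup>k)\<close> to avoid inverses; the tail has no terms of degree at most \<open>n\<close>.\<close>

lemma gauss_finite_identity:
  "bounded_overpartition_fps n * gauss_sum n = 1 + gauss_tail n (Suc n)"
proof (induction n)
  case 0
  show ?case by (simp add: gauss_sum_def gauss_tail_def bounded_overpartition_fps_0)
next
  case (Suc n)
  define a a' where "a = bounded_overpartition_fps n" and "a' = bounded_overpartition_fps (Suc n)"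
  define Q W \<epsilon> T :: "int fps" where "Q = fps_X ^ Suc n" and "W = fps_X ^ (Suc n * Suc n)"
    and "\<epsilon> = (-1) ^ Suc n" and "T = gauss_tail n (Suc n)"
  have a': "(1 - Q) * a' = (1 + Q) * a"
    using bounded_overpartition_fps_Suc[of n] unfolding a_def[symmetric] a'_def[symmetric] Q_def[symmetric]
    by (simp add: algebra_simps)
  have IH: "a * gauss_sum n = 1 + T" using Suc.IH by (simp add: a_def T_def)
  have "fps_X ^ (Suc (Suc n) * Suc n) = Q * W" by (simp add: Q_def W_def power_add)
  hence tail: "(1 - Q) * gauss_tail (Suc n) (Suc (Suc n)) - (1 + Q) * gauss_tail (Suc n) (Suc n)
      = 2 * Q - 2 * \<epsilon> * (Q * W) * a'"
    using gauss_tail_telescope[of "Suc n" "Suc n"] by (simp only: Q_def \<epsilon>_def a'_def)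
  have tail': "gauss_tail (Suc n) (Suc n) = T + \<epsilon> * (a' + a) * W"
    by (simp add: gauss_tail_def T_def \<epsilon>_def W_def a_def a'_def)
  \<comment> \<open>Multiplying by \<open>1 - Q\<close> lets the telescoping identity pass from the
    tail with parameter \<open>n + 2\<close> to the one with \<open>n + 1\<close>, whose last
    summand is then split off.\<close>
  have "(1 - Q) * (1 + gauss_tail (Suc n) (Suc (Suc n)))
      = (1 - Q) + ((1 + Q) * gauss_tail (Suc n) (Suc n) + (2 * Q - 2 * \<epsilon> * (Q * W) * a'))"
    unfolding tail[symmetric] by (simp add: algebra_simps)
  also have "\<dots> = (1 + Q) * (1 + T) + \<epsilon> * W * ((1 - Q) * a' + (1 + Q) * a)"
    unfolding tail' by (simp add: algebra_simps)
  also have "\<dots> = (1 + Q) * a * (gauss_sum n + 2 * \<epsilon> * W)"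
    unfolding a' IH[symmetric] by (simp add: algebra_simps)
  also have "\<dots> = (1 - Q) * (a' * gauss_sum (Suc n))"
    unfolding a'[symmetric] gauss_sum_Suc \<epsilon>_def W_def by (simp only: mult.assoc)
  finally have "(1 - Q) * (1 + gauss_tail (Suc n) (Suc (Suc n))) = (1 - Q) * (a' * gauss_sum (Suc n))" .
  moreover have "(1 - Q) $ 0 \<noteq> 0" by (simp add: Q_def)
  hence "1 - Q \<noteq> 0" by auto
  ultimately show ?case by (simp add: a'_def)
qed

section \<open>The theta series and its inverse\<close>

definition square_count :: "nat \<Rightarrow> nat" where
  "square_count n = card {a :: int. a ^ 2 = int n}"

definition theta_fps :: "int fps" where
  "theta_fps = Abs_fps (\<lambda>n. int (square_count n))"

lemma finite_int_square_eq: "finite {a :: int. a ^ 2 = n}"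
proof (rule finite_subset)
  show "{a :: int. a ^ 2 = n} \<subseteq> {- n..n}"
  proof
    fix a :: int assume "a \<in> {a. a ^ 2 = n}"
    thus "a \<in> {- n..n}" using abs_le_square_int[of a] by auto
  qed
qed simp

lemma gauss_sum_nth:
  assumes "k \<le> n"
  shows "gauss_sum n $ k = (-1) ^ k * int (square_count k)"
proof -
  have "{a :: int. a ^ 2 = int k} \<subseteq> {- int n..int n}"
  proof
    fix a :: int assume "a \<in> {a. a ^ 2 = int k}"
    thus "a \<in> {- int n..int n}" using assms abs_le_square_int[of a] by auto
  qed
  hence eq: "{a \<in> {- int n..int n}. k = nat (a ^ 2)} = {a. a ^ 2 = int k}" by auto
  have "((-1) ^ i * fps_X ^ i :: int fps) $ k = (if k = i then (-1) ^ k else 0)" for i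
    by (auto simp: minus_one_power_iff fps_X_power_nth)
  hence "gauss_sum n $ k = (\<Sum>j\<in>{- int n..int n}. if k = nat (j ^ 2) then (-1) ^ k else 0)"
    by (simp add: gauss_sum_def fps_sum_nth)
  also have "\<dots> = (\<Sum>j\<in>{a \<in> {- int n..int n}. k = nat (a ^ 2)}. (-1) ^ k)"
    by (rule sum.inter_filter[symmetric]) simp
  also have "\<dots> = (-1) ^ k * int (square_count k)"
    unfolding eq by (simp add: square_count_def)
  finally show ?thesis .
qed

lemma gauss_tail_nth: "k < n \<Longrightarrow> gauss_tail m n $ k = 0"
  unfolding gauss_tail_def fps_sum_nth
  by (intro sum.neutral ballI) (simp add: fps_X_power_mult_right_nth)

definition signed_overpartition_fps :: "int fps" where
  "signed_overpartition_fps = Abs_fps (\<lambda>n. (-1) ^ n * int (overpartition_count n))"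

text \<open>Only indices up to \<open>n\<close> enter the coefficient of degree \<open>n\<close>;
  there the bounded series and \<open>gauss_sum n\<close> already have their limiting coefficients,
  while the tail starts at degree \<open>n + 1\<close> or later.\<close>

lemma signed_overpartition_fps_mult_theta: "signed_overpartition_fps * theta_fps = 1"
proof (rule fps_ext)
  fix n
  have "(signed_overpartition_fps * theta_fps) $ n
      = (\<Sum>i=0..n. (-1) ^ n * (bounded_overpartition_fps n $ i * gauss_sum n $ (n - i)))"
    unfolding fps_mult_nth
  proof (rule sum.cong)
    fix i assume i: "i \<in> {0..n}"
    have sgn: "(-1 :: int) ^ n * (-1) ^ (n - i) = (-1) ^ i"
      using i by (simp add: minus_one_power_iff)
    show "signed_overpartition_fps $ i * theta_fps $ (n - i)
        = (-1) ^ n * (bounded_overpartition_fps n $ i * gauss_sum n $ (n - i))"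
      using i by (simp add: signed_overpartition_fps_def theta_fps_def gauss_sum_nth
          bounded_overpartition_fps_def card_bounded_overpartitions_eq sgn[symmetric])
  qed simp
  also have "\<dots> = (-1) ^ n * (bounded_overpartition_fps n * gauss_sum n) $ n"
    by (simp add: fps_mult_nth sum_distrib_left)
  also have "\<dots> = 1 $ n" by (simp add: gauss_finite_identity gauss_tail_nth)
  finally show "(signed_overpartition_fps * theta_fps) $ n = 1 $ n" .
qed

section \<open>Overpartitions modulo 5\<close>

text \<open>Frobenius: modulo 5, taking fifth powers is additive and fixes constants, so a
  truncation of \<open>f\<close> has a fifth power congruent to the corresponding truncation
  \<open>g\<close> of \<open>f(q^5)\<close>. Truncating beyond degree \<open>n\<close> does not
  change the coefficient of degree \<open>n\<close> of the fifth power.\<close>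

lemma fps_power5_cong:
  fixes f :: "int fps"
  shows "[(f ^ 5) $ n = (if 5 dvd n then f $ (n div 5) else 0)] (mod 5)"
proof -
  have add: "5 dvd (x + y) ^ 5 - (x ^ 5 + y ^ 5)" for x y :: "int fps"
  proof -
    have "(x + y) ^ 5 - (x ^ 5 + y ^ 5) = 5 * (x ^ 4 * y + 2 * x ^ 3 * y ^ 2 + 2 * x ^ 2 * y ^ 3 + x * y ^ 4)"
      by (simp add: eval_nat_numeral algebra_simps)
    thus ?thesis by (simp only: dvd_triv_left)
  qed
  have const: "5 dvd fps_const c ^ 5 - fps_const c" for c :: int
  proof -
    have "[c ^ 5 = c] (mod 5)"
    proof -
      have "0 \<le> c mod 5" "c mod 5 < 5" by simp_all
      hence "c mod 5 \<in> {0, 1, 2, 3, 4}" by auto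
      hence "(c mod 5) ^ 5 mod 5 = c mod 5" by auto
      thus ?thesis by (simp add: cong_def power_mod)
    qed
    then obtain d where d: "c ^ 5 - c = 5 * d" by (auto simp: cong_iff_dvd_diff)
    have "fps_const c ^ 5 - fps_const c = fps_const (c ^ 5 - c)"
      by (simp only: fps_const_power fps_const_sub)
    also have "\<dots> = 5 * fps_const d" by (simp only: d fps_const_mult[symmetric] numeral_fps_const)
    finally show ?thesis by (simp only: dvd_triv_left)
  qed
  define g where "g m = (\<Sum>i<m. fps_const (f $ i) * fps_X ^ (5 * i))" for m
  have cutoff: "5 dvd fps_cutoff m f ^ 5 - g m" for m
  proof (induction m)
    case (Suc m)
    define c A Y where "c = fps_const (f $ m)" and "A = fps_cutoff m f" and "Y = (fps_X :: int fps) ^ (5 * m)"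
    have "fps_cutoff (Suc m) f = A + c * fps_X ^ m"
      by (rule fps_ext) (auto simp: A_def c_def fps_X_power_nth less_Suc_eq)
    moreover have "g (Suc m) = g m + c * Y" by (simp add: g_def c_def Y_def)
    moreover have "(c * fps_X ^ m) ^ 5 = c ^ 5 * Y"
      by (simp only: Y_def power_mult_distrib power_mult[symmetric] mult.commute[of 5])
    ultimately have "fps_cutoff (Suc m) f ^ 5 - g (Suc m)
        = ((A + c * fps_X ^ m) ^ 5 - (A ^ 5 + (c * fps_X ^ m) ^ 5)) + (A ^ 5 - g m) + (c ^ 5 - c) * Y"
      by (simp only: left_diff_distrib) simp
    also have "5 dvd \<dots>"
      unfolding A_def c_def by (intro dvd_add dvd_mult2 add Suc.IH const)
    finally show ?case .
  qed (simp add: g_def)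
  define P where "P = fps_cutoff (Suc n) f"
  have "f - P = fps_shift (Suc n) f * fps_X ^ Suc n"
    using fps_shift_cutoff[of "Suc n" f] unfolding P_def by (metis add_diff_cancel_right')
  moreover have "f ^ 5 - P ^ 5 = (f ^ 4 + f ^ 3 * P + f ^ 2 * P ^ 2 + f * P ^ 3 + P ^ 4) * (f - P)"
    by (simp add: eval_nat_numeral algebra_simps)
  ultimately have "f ^ 5 - P ^ 5 = ((f ^ 4 + f ^ 3 * P + f ^ 2 * P ^ 2 + f * P ^ 3 + P ^ 4)
      * fps_shift (Suc n) f) * fps_X ^ Suc n" by (simp only: mult.assoc)
  hence "(f ^ 5 - P ^ 5) $ n = 0" by (simp add: fps_X_power_mult_right_nth del: power_Suc)
  moreover obtain h where "P ^ 5 - g (Suc n) = 5 * h" using cutoff unfolding P_def by blast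
  hence "(P ^ 5 - g (Suc n)) $ n = 5 * (h $ n)" by (simp add: numeral_fps_const)
  moreover have "g (Suc n) $ n = (if 5 dvd n then f $ (n div 5) else 0)"
  proof (cases "5 dvd n")
    case True
    then obtain k where k: "n = 5 * k" by blast
    thus ?thesis by (simp add: g_def fps_sum_nth fps_X_power_nth if_distrib sum.delta' cong: if_cong)
  next
    case False
    hence "n \<noteq> 5 * i" for i by auto
    thus ?thesis using False by (auto simp: g_def fps_sum_nth fps_X_power_nth)
  qed
  ultimately have "(f ^ 5) $ n - (if 5 dvd n then f $ (n div 5) else 0) = 5 * (h $ n)" by simp
  thus ?thesis by (simp add: cong_iff_dvd_diff)
qed

text \<open>A Cauchy product with theta adds one square variable to the form \<open>Q\<close>. The
  carrier is arbitrary and finiteness is concluded as well, so that the result can be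
  iterated.\<close>

lemma theta_fps_mult:
  fixes Q :: "'a \<Rightarrow> int"
  assumes fin: "\<And>n. finite {x. Q x = int n}" and nonneg: "\<And>x. Q x \<ge> 0"
  shows "theta_fps * Abs_fps (\<lambda>n. int (card {x. Q x = int n}))
      = Abs_fps (\<lambda>n. int (card {u. fst u ^ 2 + Q (snd u) = int n}))"
    and "finite {u :: int \<times> 'a. fst u ^ 2 + Q (snd u) = int n}"
proof -
  have eq: "{u :: int \<times> 'a. fst u ^ 2 + Q (snd u) = int n}
      = (\<Union>i\<in>{0..n}. {a. a ^ 2 = int i} \<times> {x. Q x = int (n - i)})" for n
  proof (intro equalityI subsetI)
    fix u assume "u \<in> {u :: int \<times> 'a. fst u ^ 2 + Q (snd u) = int n}"
    then obtain a x where u: "u = (a, x)" "a ^ 2 + Q x = int n" by (cases u) auto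
    define i where "i = nat (a ^ 2)"
    have "a ^ 2 = int i" "i \<le> n" using u nonneg[of x] by (auto simp: i_def)
    thus "u \<in> (\<Union>i\<in>{0..n}. {a. a ^ 2 = int i} \<times> {x. Q x = int (n - i)})"
      using u by (auto simp: of_nat_diff)
  qed (auto simp: of_nat_diff)
  show "finite {u :: int \<times> 'a. fst u ^ 2 + Q (snd u) = int n}"
    unfolding eq by (intro finite_UN_I finite_cartesian_product fin finite_int_square_eq) simp
  show "theta_fps * Abs_fps (\<lambda>n. int (card {x. Q x = int n}))
      = Abs_fps (\<lambda>n. int (card {u. fst u ^ 2 + Q (snd u) = int n}))"
  proof (rule fps_ext)
    fix n
    have "card {u. fst u ^ 2 + Q (snd u) = int n}
        = (\<Sum>i\<in>{0..n}. card ({a :: int. a ^ 2 = int i} \<times> {x. Q x = int (n - i)}))"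
      unfolding eq by (intro card_UN_disjoint ballI impI finite_cartesian_product fin finite_int_square_eq) auto
    thus "(theta_fps * Abs_fps (\<lambda>n. int (card {x. Q x = int n}))) $ n
        = Abs_fps (\<lambda>n. int (card {u. fst u ^ 2 + Q (snd u) = int n})) $ n"
      by (simp add: fps_mult_nth theta_fps_def square_count_def card_cartesian_product)
  qed
qed

lemma theta_fps_cube: "theta_fps ^ 3 = Abs_fps (\<lambda>n. int (card (pure_quats (int n))))"
  and theta_fps_power4: "theta_fps ^ 4 = Abs_fps (\<lambda>n. int (card {x. qnorm x = int n}))"
proof -
  have 1: "theta_fps = Abs_fps (\<lambda>n. int (card {a :: int. a ^ 2 = int n}))"
    by (simp add: theta_fps_def square_count_def)
  let ?Q2 = "\<lambda>u :: int \<times> int. fst u ^ 2 + snd u ^ 2"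
  let ?Q3 = "\<lambda>u :: int \<times> int \<times> int. fst u ^ 2 + ?Q2 (snd u)"
  let ?Q4 = "\<lambda>u :: int \<times> int \<times> int \<times> int. fst u ^ 2 + ?Q3 (snd u)"
  note 2 = theta_fps_mult[of "\<lambda>b :: int. b ^ 2", OF finite_int_square_eq zero_le_power2]
  note 3 = theta_fps_mult[of ?Q2, OF 2(2)]
  note 4 = theta_fps_mult[of ?Q3, OF 3(2)]
  have "theta_fps ^ 3 = theta_fps * (theta_fps * theta_fps)" by (simp add: power3_eq_cube)
  also have "\<dots> = Abs_fps (\<lambda>n. int (card {u. ?Q3 u = int n}))"
    unfolding 2(1)[folded 1] by (rule 3) simp
  finally have cube: "theta_fps ^ 3 = Abs_fps (\<lambda>n. int (card {u. ?Q3 u = int n}))" .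
  have "card {u. ?Q3 u = int n} = card (pure_quats (int n))" for n
    by (rule bij_betw_same_card[of "\<lambda>(a, b, c). IQuat 0 a b c"],
        rule bij_betwI[where g = "\<lambda>x. (q1 x, q2 x, q3 x)"])
      (auto simp: pure_quats_def qnorm_def intro: iquat_eqI)
  thus "theta_fps ^ 3 = Abs_fps (\<lambda>n. int (card (pure_quats (int n))))"
    unfolding cube by simp
  have "theta_fps ^ 4 = theta_fps * theta_fps ^ 3" by (simp add: eval_nat_numeral)
  also have "\<dots> = Abs_fps (\<lambda>n. int (card {u. ?Q4 u = int n}))"
    unfolding cube by (rule 4) simp_all
  finally have fourth: "theta_fps ^ 4 = Abs_fps (\<lambda>n. int (card {u. ?Q4 u = int n}))" .
  have "card {u. ?Q4 u = int n} = card {x. qnorm x = int n}" for n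
    by (rule bij_betw_same_card[of "\<lambda>(a, b, c, d). IQuat a b c d"],
        rule bij_betwI[where g = "\<lambda>x. (q0 x, q1 x, q2 x, q3 x)"])
      (auto simp: qnorm_def)
  thus "theta_fps ^ 4 = Abs_fps (\<lambda>n. int (card {x. qnorm x = int n}))"
    unfolding fourth by simp
qed

text \<open>Here \<open>E = 1 / \<phi>\<close>, so \<open>\<phi>^5 E = \<phi>^4\<close>. As
  \<open>\<phi>^5\<close> is congruent to \<open>\<phi>(q^5)\<close>, extracting the exponents
  divisible by 5 gives \<open>B \<phi>\<close> on the left and, by the four-square congruence,
  \<open>\<phi>^4\<close> on the right; multiplying by \<open>E\<close> leaves \<open>B\<close>
  congruent to \<open>\<phi>^3\<close>.\<close>

lemma overpartition_count_5_cong: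
  "[(-1) ^ n * int (overpartition_count (5 * n)) = int (card (pure_quats (int n)))] (mod 5)"
proof -
  define E where "E = signed_overpartition_fps"
  define B where "B = Abs_fps (\<lambda>n. E $ (5 * n))"
  have E: "E * theta_fps = 1" unfolding E_def by (rule signed_overpartition_fps_mult_theta)
  have "[(B * theta_fps) $ n = (theta_fps ^ 4) $ n] (mod 5)" for n
  proof -
    have "(\<Sum>i\<in>{0..5 * n}. (if 5 dvd i then theta_fps $ (i div 5) else 0) * E $ (5 * n - i))
        = (\<Sum>i\<in>(\<lambda>k. 5 * k) ` {0..n}. theta_fps $ (i div 5) * E $ (5 * n - i))"
      by (rule sum.mono_neutral_cong_right) auto
    also have "\<dots> = (\<Sum>k\<in>{0..n}. theta_fps $ k * B $ (n - k))"
      by (subst sum.reindex) (auto simp: inj_on_def B_def diff_mult_distrib2)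
    also have "\<dots> = (theta_fps * B) $ n" by (simp add: fps_mult_nth)
    finally have "[(theta_fps ^ 5 * E) $ (5 * n) = (theta_fps * B) $ n] (mod 5)"
      using cong_sum[of "{0..5 * n}" "\<lambda>i. (theta_fps ^ 5) $ i * E $ (5 * n - i)"
          "\<lambda>i. (if 5 dvd i then theta_fps $ (i div 5) else 0) * E $ (5 * n - i)" 5]
        fps_power5_cong[of theta_fps]
      by (simp add: fps_mult_nth cong_mult)
    moreover have "theta_fps ^ 5 * E = theta_fps ^ 4 * (E * theta_fps)"
      by (simp add: eval_nat_numeral mult_ac)
    moreover have "[(theta_fps ^ 4) $ (5 * n) = (theta_fps ^ 4) $ n] (mod 5)"
      using card_four_squares_5[of "int n"]
      by (simp add: theta_fps_power4 flip: cong_int_iff)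
    ultimately show ?thesis
      by (simp add: E mult.commute) (metis cong_sym cong_trans)
  qed
  hence "[(B * theta_fps * E) $ n = (theta_fps ^ 4 * E) $ n] (mod 5)"
    unfolding fps_mult_nth[of "B * theta_fps"] fps_mult_nth[of "theta_fps ^ 4"]
    by (intro cong_sum cong_mult) auto
  moreover have "B * theta_fps * E = B * (E * theta_fps)" "theta_fps ^ 4 * E = theta_fps ^ 3 * (E * theta_fps)"
    by (simp_all add: eval_nat_numeral mult_ac)
  ultimately have "[B $ n = (theta_fps ^ 3) $ n] (mod 5)" by (simp add: E)
  moreover have "(-1 :: int) ^ (5 * n) = (-1) ^ n" by (simp add: minus_one_power_iff)
  ultimately show ?thesis
    by (simp add: B_def E_def signed_overpartition_fps_def theta_fps_cube)
qed

lemma overpartition_count_prime_power: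
  fixes p N k :: nat
  assumes p: "prime p" "odd p" and N: "\<not> p dvd N" and k: "5 dvd (\<Sum>i\<le>k. p ^ i)"
  shows "overpartition_count (5 * p ^ (2 * k + 1) * N) mod 5 = 0"
proof -
  define n where "n = p ^ (2 * k + 1) * N"
  have "card (pure_quats (int n)) = (\<Sum>i\<le>k. p ^ i) * card (pure_quats (int p * int N))"
    using card_pure_prime_power[of "int p" "int N" k] p N by (simp add: n_def)
  hence "5 dvd int (card (pure_quats (int n)))"
    using k by (metis dvd_mult2 int_dvd_int_iff of_nat_numeral)
  hence "5 dvd (-1) ^ n * int (overpartition_count (5 * n))"
    using overpartition_count_5_cong[of n] by (meson cong_dvd_iff)
  hence "5 dvd int (overpartition_count (5 * n))" by (auto simp: minus_one_power_iff split: if_splits)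
  hence "5 dvd overpartition_count (5 * n)" by (metis int_dvd_int_iff of_nat_numeral)
  thus ?thesis by (simp add: n_def mult.assoc)
qed

section \<open>Geometric sums modulo 5\<close>

lemma dvd_geometric_sum_1:
  assumes "(p :: nat) mod 5 = 1"
  shows "5 dvd (\<Sum>i\<le>5 * \<alpha> + 4. p ^ i)"
proof -
  have "[(\<Sum>i\<le>5 * \<alpha> + 4. p ^ i) = (\<Sum>i\<le>5 * \<alpha> + 4. 1 ^ i)] (mod 5)"
    using assms by (intro cong_sum cong_pow) (simp add: cong_def)
  \<comment> \<open>There are \<open>5 * (\<alpha> + 1)\<close> summands.\<close>
  moreover have "5 dvd (\<Sum>i\<le>5 * \<alpha> + 4. 1 ^ i :: nat)"
    using dvd_triv_left[of 5 "\<alpha> + 1"] by simp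
  ultimately show ?thesis using cong_dvd_iff by blast
qed

text \<open>The sum splits into blocks \<open>1 + p + p ^ 2 + p ^ 3\<close> times powers of
  \<open>p\<close>; a block is \<open>(p ^ 4 - 1) / (p - 1)\<close>, which Fermat's theorem makes
  divisible by 5 for these residues.\<close>

lemma dvd_geometric_sum_234:
  assumes "(p :: nat) mod 5 \<in> {2, 3, 4}"
  shows "5 dvd (\<Sum>i\<le>4 * \<alpha> + 3. p ^ i)"
proof -
  have "[1 + p + p ^ 2 + p ^ 3 = 1 + p mod 5 + (p mod 5) ^ 2 + (p mod 5) ^ 3] (mod 5)"
    by (intro cong_add cong_pow) simp_all
  moreover have "5 dvd 1 + p mod 5 + (p mod 5) ^ 2 + (p mod 5) ^ 3" using assms by auto
  ultimately have *: "5 dvd 1 + p + p ^ 2 + p ^ 3" using cong_dvd_iff by blast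
  show ?thesis
  proof (induction \<alpha>)
    case 0
    thus ?case using * by (simp add: eval_nat_numeral)
  next
    case (Suc \<alpha>)
    have "(\<Sum>i\<le>4 * Suc \<alpha> + 3. p ^ i)
        = (\<Sum>i\<le>4 * \<alpha> + 3. p ^ i) + p ^ (4 * \<alpha> + 4) * (1 + p + p ^ 2 + p ^ 3)"
      by (simp add: eval_nat_numeral algebra_simps)
    thus ?case using Suc * by (simp only: dvd_add dvd_mult)
  qed
qed

theorem theorem4:
  fixes p N \<alpha> :: nat
  assumes "prime p" and "p \<ge> 3" and "N > 0" and "coprime N p"
  shows "(p mod 5 = 1 \<longrightarrow> overpartition_count (5 * p ^ (10 * \<alpha> + 9) * N) mod 5 = 0)
       \<and> (p mod 5 \<in> {2, 3, 4} \<longrightarrow> overpartition_count (5 * p ^ (8 * \<alpha> + 7) * N) mod 5 = 0)"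
proof -
  have odd: "odd p" using assms(1,2) by (intro prime_odd_nat) auto
  have N: "\<not> p dvd N"
    using assms(1,4) by (metis coprime_absorb_right not_prime_unit)
  have exps: "10 * \<alpha> + 9 = 2 * (5 * \<alpha> + 4) + 1" "8 * \<alpha> + 7 = 2 * (4 * \<alpha> + 3) + 1" by simp_all
  show ?thesis unfolding exps
    using overpartition_count_prime_power[OF assms(1) odd N] dvd_geometric_sum_1 dvd_geometric_sum_234
    by blast
qed

end
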